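(* Let $\mathbb{K}$ be a field, let $n\ge 3$ and $d\ge 1$ be integers, and let $\alpha=(\alpha_1,\dots,\alpha_n)$ be a sequence of integers with $1\le\alpha_1\le\cdots\le\alpha_n\le d$ and $d<\alpha_1+\cdots+\alpha_n$. Let $J$ be the presentation ideal of the algebra of Veronese type $\mathcal{A}_{d,\alpha}$, let $\operatorname{in}(J)$ be its (sorting) initial ideal, and let $\prec$ be a total order on the set $\operatorname{MC}(\mathcal{G})$ of maximal cliques of the sorting graph $\mathcal{G}$ satisfying the rules of order (a), (b), (c) given in the context. Then $\prec$ induces a linear quotient order on the minimal monomial generating set $G(\operatorname{in}(J)^{\vee})=\{\mathbf{T}_{A^{\complement}}: A\in\operatorname{MC}(\mathcal{G})\}$ of the Alexander dual $\operatorname{in}(J)^\vee$; that is, for every $A\in\operatorname{MC}(\mathcal{G})$ the colon ideal $$\langle \mathbf{T}_{B^{\complement}}: B\in\operatorname{MC}(\mathcal{G}),\ B\prec A\rangle :_{\mathbb{K}[\mathbf{T}]}\mathbf{T}_{A^{\complement}}$$ is generated by a subset of the variables of $\mathbb{K}[\mathbf{T}]$.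
   Context: **Sorting.** $V_{n,d}=\{a\in\mathbb{N}^n:a_1+\cdots+a_n=d\}$ and $V_{n,d}^{\alpha}=\{a\in V_{n,d}:a_i\le\alpha_i\ \forall i\}$ ($0\in\mathbb{N}$). For $a,b\in V_{n,d}$ write $x^ax^b=x_{i_1}x_{i_2}\cdots x_{i_{2d}}$ with $i_1\le\cdots\le i_{2d}$; then $\operatorname{sort}(a,b)=(a',b')$ with $x^{a'}=x_{i_1}x_{i_3}\cdots x_{i_{2d-1}}$ and $x^{b'}=x_{i_2}x_{i_4}\cdots x_{i_{2d}}$. The pair $(a,b)$ is sorted if $\operatorname{sort}(a,b)=(a,b)$. $a>_{\mathrm{lex}}b$ means the leftmost nonzero entry of $a-b$ is positive. **Graph.** $\mathcal{G}=\mathcal{G}(d,\alpha)$ is the simple graph on $V_{n,d}^{\alpha}$ in which $\{a,b\}$ with $a>_{\mathrm{lex}}b$ is an edge iff $(a,b)$ is sorted. $\operatorname{MC}(\mathcal{G})$ is the set of its inclusion-maximal cliques. Every maximal clique has exactly $n$ elements; writing $A=(a^1,\dots,a^n)$ means $A=\{a^1,\dots,a^n\}$ with $a^1>_{\mathrm{lex}}\cdots>_{\mathrm{lex}}a^n$. **Ideals.** $\mathcal{A}_{d,\alpha}=\mathbb{K}[x^a:a\in V_{n,d}^\alpha]\subset \mathbb{K}[x_1,\dots,x_n]$, $\mathbb{K}[\mathbf T]=\mathbb{K}[T_a:a\in V_{n,d}^\alpha]$, and $J$ is the kernel of $T_a\mapsto x^a$. By Sturmfels, there is a term order for which the binomials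 $T_aT_b-T_{a'}T_{b'}$ (with $(a,b)$ unsorted and $\operatorname{sort}(a,b)=(a',b')$) form a Gröbner basis of $J$ with leading terms $T_aT_b$; $\operatorname{in}(J)$ is the initial ideal for such an order, i.e. the edge ideal of the complement graph of $\mathcal{G}$. For a maximal clique $A$, $\mathbf T_{A^\complement}=\prod_{v\in V_{n,d}^\alpha\setminus A}T_v$. The Alexander dual $\operatorname{in}(J)^\vee$ is minimally generated by the $\mathbf T_{A^\complement}$, $A\in\operatorname{MC}(\mathcal{G})$. **Signature.** For every maximal clique $A=(a^1,\dots,a^n)$ there is a unique permutation $\operatorname{sgn}(A)=(s_1,\dots,s_{n-1})$ of $\{1,\dots,n-1\}$ such that, for each $i$, $a^{i+1}$ is obtained from $a^i$ by decreasing coordinate $s_i$ by $1$ and increasing coordinate $s_i+1$ by $1$. **Equivalence classes and rank.** Maximal cliques $A=(a^1,\dots,a^n)$ and $B=(b^1,\dots,b^n)$ are equivalent iff $a^1=b^1$ (equivalently $a^n=b^n$). $\mathcal{E}_A$ is the class of $A$. Let $\eta$ be the $>_{\mathrm{lex}}$-smallest element of $V_{n,d}^\alpha$, and $\operatorname{rank}(a)=\sum_{j=1}^{n-1}(a_j-\eta_j)(n-j)$ for $a\in V_{n,d}$. Put $\operatorname{rank}(A)=\operatorname{rank}(\mathcal{E}_A)=\operatorname{rank}(a^n)$. **Distinguished clique $L(\mathcal{E})$.** Let $\mathcal{E}$ be an equivalence class whose members start with $a^1=(a_1^1,\dots,a_n^1)$ (so $a^1_1\ge1$, $a_n^1\le\alpha_n-1$).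 If $a_1^1>1$ set $\kappa_1=0$; if $a_1^1=1$ let $\kappa_1$ be the largest integer with $1\le\kappa_1\le n-1$ and $a_j^1=0$ for all $2\le j\le\kappa_1$ (so $\kappa_1=1$ if $a_2^1>0$). If $a_n^1<\alpha_n-1$ set $\kappa_2=n+1$; if $a_n^1=\alpha_n-1$ let $\kappa_2$ be the smallest integer with $2\le\kappa_2\le n$ and $a_j^1=\alpha_j$ for all $\kappa_2\le j\le n-1$ (so $\kappa_2=n$ if $a_{n-1}^1<\alpha_{n-1}$). Then $\kappa_1<\kappa_2$. In each class $\mathcal{E}$ one fixes, once and for all, a maximal clique $L=L(\mathcal{E})\in\mathcal{E}$ with $\operatorname{sgn}(L)=(\tau_1,\dots,\tau_{\kappa_2-\kappa_1-2},\,n-1,n-2,\dots,\kappa_2-1,\,1,2,\dots,\kappa_1)$ for some $\tau_i$'s if $\kappa_1<\kappa_2-1$, and $\operatorname{sgn}(L)=(n-1,n-2,\dots,\kappa_2,\,1,2,\dots,\kappa_1)$ if $\kappa_1=\kappa_2-1$ (blocks may be empty; such $L$ exists). With $\tau=\operatorname{sgn}(L)=(\tau_1,\dots,\tau_{n-1})$, the relative signature of $A\in\mathcal{E}$ with $\operatorname{sgn}(A)=(k_1,\dots,k_{n-1})$ is $\operatorname{sgn}_\tau(A)=(s_1,\dots,s_{n-1})$ where $\tau_{s_i}=k_i$. **Rules of order.** $\prec$ is a fixed total order on $\operatorname{MC}(\mathcal{G})$ such that: (a) if $\operatorname{rank}(B)<\operatorname{rank}(A)$ then $B\prec A$; (b)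 if $\operatorname{rank}(B)=\operatorname{rank}(A)$, $\mathcal{E}_A\ne\mathcal{E}_B$ and $B\prec A$, then $B'\prec A'$ for all $A'\in\mathcal{E}_A$, $B'\in\mathcal{E}_B$; (c) if $A,B$ lie in the same class $\mathcal{E}$ and $\tau=\operatorname{sgn}(L(\mathcal{E}))$, then $B\prec A$ iff the first nonzero entry of $\operatorname{sgn}_\tau(B)-\operatorname{sgn}_\tau(A)$ is negative. *)

theory Defs
  imports "HOL-Algebra.RingHom" "HOL-Library.Poly_Mapping"
begin

type_synonym ('v, 'k) mpoly = "('v \<Rightarrow>\<^sub>0 nat) \<Rightarrow>\<^sub>0 'k"

text \<open>\<open>poly_ring V\<close> is \<open>K[v : v \<in> V]\<close>, as a subring of the ring of polynomials in all
  elements of type \<open>'v\<close>; the field \<open>K\<close> is the type \<open>'k\<close>.\<close>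

definition poly_ring :: "'v set \<Rightarrow> ('v, 'k::field) mpoly ring" where
  "poly_ring V = \<lparr>carrier = {p. \<forall>m\<in>Poly_Mapping.keys p. Poly_Mapping.keys m \<subseteq> V},
     monoid.mult = (*), one = 1, zero = 0, add = (+)\<rparr>"

definition monomial :: "('v \<Rightarrow>\<^sub>0 nat) \<Rightarrow> ('v, 'k::field) mpoly" where
  "monomial m = Poly_Mapping.single m 1"

definition var :: "'v \<Rightarrow> ('v, 'k::field) mpoly" where
  "var v = monomial (Poly_Mapping.single v 1)"

definition sqfree_mono :: "'v set \<Rightarrow> ('v, 'k::field) mpoly" where
  "sqfree_mono F = (\<Prod>v\<in>F. var v)"

text \<open>The value at \<open>p\<close> of the \<open>K\<close>-algebra homomorphism sending each variable \<open>v\<close> to \<open>h v\<close>;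
  \<open>Poly_Mapping.single 0 c\<close> is the constant polynomial \<open>c\<close>.\<close>

definition poly_subst :: "('v \<Rightarrow> ('w, 'k::field) mpoly) \<Rightarrow> ('v, 'k) mpoly \<Rightarrow> ('w, 'k) mpoly" where
  "poly_subst h p = (\<Sum>m\<in>Poly_Mapping.keys p. Poly_Mapping.single 0 (Poly_Mapping.lookup p m) *
     (\<Prod>v\<in>Poly_Mapping.keys m. h v ^ Poly_Mapping.lookup m v))"

definition colon_ideal :: "('a, 'm) ring_scheme \<Rightarrow> 'a set \<Rightarrow> 'a \<Rightarrow> 'a set" where
  "colon_ideal R I g = {f \<in> carrier R. f \<otimes>\<^bsub>R\<^esub> g \<in> I}"

definition minimal_monomial_generating_set ::
    "'v set \<Rightarrow> ('v, 'k::field) mpoly set \<Rightarrow> ('v, 'k) mpoly set \<Rightarrow> bool" where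
  "minimal_monomial_generating_set V I G \<longleftrightarrow>
     G \<subseteq> {monomial m | m. Poly_Mapping.keys m \<subseteq> V} \<and> Idl\<^bsub>poly_ring V\<^esub> G = I \<and>
     (\<forall>G'. G' \<subset> G \<longrightarrow> Idl\<^bsub>poly_ring V\<^esub> G' \<noteq> I)"

text \<open>Term orders are strict: \<open>(m, m') \<in> r\<close> means that \<open>m\<close> is smaller than \<open>m'\<close>. Monomials are
  identified with their exponents, so that \<open>0\<close> stands for the monomial \<open>1\<close>.\<close>

definition term_order :: "'v set \<Rightarrow> ('v \<Rightarrow>\<^sub>0 nat) rel \<Rightarrow> bool" where
  "term_order V r \<longleftrightarrow> (let M = {m. Poly_Mapping.keys m \<subseteq> V} in
     r \<subseteq> M \<times> M \<and> strict_linear_order_on M r \<and> (\<forall>m\<in>M. m \<noteq> 0 \<longrightarrow> (0, m) \<in> r) \<and>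
     (\<forall>m\<in>M. \<forall>m'\<in>M. \<forall>k\<in>M. (m, m') \<in> r \<longrightarrow> (m + k, m' + k) \<in> r))"

definition lead_exp :: "('v \<Rightarrow>\<^sub>0 nat) rel \<Rightarrow> ('v, 'k::field) mpoly \<Rightarrow> ('v \<Rightarrow>\<^sub>0 nat)" where
  "lead_exp r p = (THE m. m \<in> Poly_Mapping.keys p \<and>
     (\<forall>m'\<in>Poly_Mapping.keys p. m' \<noteq> m \<longrightarrow> (m', m) \<in> r))"

definition initial_ideal ::
    "'v set \<Rightarrow> ('v \<Rightarrow>\<^sub>0 nat) rel \<Rightarrow> ('v, 'k::field) mpoly set \<Rightarrow> ('v, 'k) mpoly set" where
  "initial_ideal V r I = Idl\<^bsub>poly_ring V\<^esub> {monomial (lead_exp r p) | p. p \<in> I \<and> p \<noteq> 0}"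

definition groebner_basis ::
    "'v set \<Rightarrow> ('v \<Rightarrow>\<^sub>0 nat) rel \<Rightarrow> ('v, 'k::field) mpoly set \<Rightarrow> ('v, 'k) mpoly set \<Rightarrow> bool" where
  "groebner_basis V r I G \<longleftrightarrow> finite G \<and> G \<subseteq> I \<and>
     Idl\<^bsub>poly_ring V\<^esub> {monomial (lead_exp r p) | p. p \<in> G \<and> p \<noteq> 0} = initial_ideal V r I"

text \<open>The Alexander dual of a squarefree monomial ideal is the Stanley-Reisner ideal of the dual
  of its Stanley-Reisner complex.\<close>

definition sr_complex :: "'v set \<Rightarrow> ('v, 'k::field) mpoly set \<Rightarrow> 'v set set" where
  "sr_complex V I = {F. F \<subseteq> V \<and> sqfree_mono F \<notin> I}"

definition sr_ideal :: "'v set \<Rightarrow> 'v set set \<Rightarrow> ('v, 'k::field) mpoly set" where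
  "sr_ideal V \<Delta> = Idl\<^bsub>poly_ring V\<^esub> {sqfree_mono F | F. F \<subseteq> V \<and> F \<notin> \<Delta>}"

definition dual_complex :: "'v set \<Rightarrow> 'v set set \<Rightarrow> 'v set set" where
  "dual_complex V \<Delta> = {V - F | F. F \<subseteq> V \<and> F \<notin> \<Delta>}"

definition alexander_dual :: "'v set \<Rightarrow> ('v, 'k::field) mpoly set \<Rightarrow> ('v, 'k) mpoly set" where
  "alexander_dual V I = sr_ideal V (dual_complex V (sr_complex V I))"

text \<open>A vector \<open>a\<close> in \<open>\<nat>\<^sup>n\<close> is a finitely supported function with support in \<open>{1..n}\<close>, which is also
  the exponent of the monomial \<open>x\<^sup>a\<close>. The library order \<open><\<close> on \<open>nat \<Rightarrow>\<^sub>0 nat\<close> compares the values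
  at the least index where they differ; \<open>a > b\<close> thus means that the leftmost nonzero entry of \<open>a - b\<close> is positive.\<close>

type_synonym vec = "nat \<Rightarrow>\<^sub>0 nat"

definition veronese_set :: "nat \<Rightarrow> nat \<Rightarrow> (nat \<Rightarrow> nat) \<Rightarrow> vec set" where
  "veronese_set n d \<alpha> = {a. Poly_Mapping.keys a \<subseteq> {1..n} \<and>
     (\<Sum>i\<in>{1..n}. Poly_Mapping.lookup a i) = d \<and> (\<forall>i\<in>{1..n}. Poly_Mapping.lookup a i \<le> \<alpha> i)}"

text \<open>The indices \<open>i\<^sub>1 \<le> i\<^sub>2 \<le> \<dots>\<close> with \<open>x\<^sup>c = x\<^bsub>i\<^sub>1\<^esub> x\<^bsub>i\<^sub>2\<^esub> \<dots>\<close>, and conversely. List positions count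
  from \<open>0\<close>, so the odd-numbered factors are those at even positions.\<close>

definition index_word :: "vec \<Rightarrow> nat list" where
  "index_word c = concat (map (\<lambda>i. replicate (Poly_Mapping.lookup c i) i)
     (sorted_list_of_set (Poly_Mapping.keys c)))"

definition vec_of_word :: "nat list \<Rightarrow> vec" where
  "vec_of_word w = (\<Sum>i\<leftarrow>w. Poly_Mapping.single i 1)"

definition sort_pair :: "vec \<Rightarrow> vec \<Rightarrow> vec \<times> vec" where
  "sort_pair a b = (let w = index_word (a + b) in
     (vec_of_word (nths w {k. even k}), vec_of_word (nths w {k. odd k})))"

definition sorted_pair :: "vec \<Rightarrow> vec \<Rightarrow> bool" where
  "sorted_pair a b \<longleftrightarrow> sort_pair a b = (a, b)"

definition sorting_edges :: "nat \<Rightarrow> nat \<Rightarrow> (nat \<Rightarrow> nat) \<Rightarrow> vec set set" where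
  "sorting_edges n d \<alpha> = {{a, b} | a b. a \<in> veronese_set n d \<alpha> \<and> b \<in> veronese_set n d \<alpha> \<and>
     a > b \<and> sorted_pair a b}"

definition clique :: "nat \<Rightarrow> nat \<Rightarrow> (nat \<Rightarrow> nat) \<Rightarrow> vec set \<Rightarrow> bool" where
  "clique n d \<alpha> A \<longleftrightarrow> A \<subseteq> veronese_set n d \<alpha> \<and>
     (\<forall>a\<in>A. \<forall>b\<in>A. a \<noteq> b \<longrightarrow> {a, b} \<in> sorting_edges n d \<alpha>)"

definition MC :: "nat \<Rightarrow> nat \<Rightarrow> (nat \<Rightarrow> nat) \<Rightarrow> vec set set" where
  "MC n d \<alpha> = {A. clique n d \<alpha> A \<and> (\<forall>B. clique n d \<alpha> B \<and> A \<subseteq> B \<longrightarrow> B = A)}"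

text \<open>The list \<open>[a\<^sup>1, \<dots>, a\<^sup>n]\<close> of the elements of \<open>A\<close>, lexicographically decreasing.\<close>

definition vertices :: "vec set \<Rightarrow> vec list" where
  "vertices A = rev (sorted_list_of_set A)"

text \<open>Signatures are lists \<open>[s\<^sub>1, \<dots>, s\<^bsub>n-1\<^esub>]\<close> with entries in \<open>{1..n-1}\<close>: the entry at position \<open>i\<close>
  is \<open>s\<^bsub>i+1\<^esub>\<close>.\<close>

definition signature :: "nat \<Rightarrow> vec set \<Rightarrow> nat list" where
  "signature n A = (THE s. length s = n - 1 \<and> distinct s \<and> set s = {1..n - 1} \<and>
     (\<forall>i < n - 1. vertices A ! (i + 1) + Poly_Mapping.single (s ! i) 1 =
        vertices A ! i + Poly_Mapping.single (s ! i + 1) 1))"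

definition clique_class :: "nat \<Rightarrow> nat \<Rightarrow> (nat \<Rightarrow> nat) \<Rightarrow> vec set \<Rightarrow> vec set set" where
  "clique_class n d \<alpha> A = {B \<in> MC n d \<alpha>. hd (vertices B) = hd (vertices A)}"

definition vec_rank :: "nat \<Rightarrow> nat \<Rightarrow> (nat \<Rightarrow> nat) \<Rightarrow> vec \<Rightarrow> int" where
  "vec_rank n d \<alpha> a = (let \<eta> = Min (veronese_set n d \<alpha>) in
     (\<Sum>j\<in>{1..n - 1}. (int (Poly_Mapping.lookup a j) - int (Poly_Mapping.lookup \<eta> j)) * int (n - j)))"

definition clique_rank :: "nat \<Rightarrow> nat \<Rightarrow> (nat \<Rightarrow> nat) \<Rightarrow> vec set \<Rightarrow> int" where
  "clique_rank n d \<alpha> A = vec_rank n d \<alpha> (last (vertices A))"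

text \<open>Here \<open>a\<close> is the first vertex \<open>a\<^sup>1\<close> of the members of a class, so that \<open>a\<^sup>1\<^sub>1 \<ge> 1\<close> and
  \<open>a\<^sup>1\<^sub>n < \<alpha>\<^sub>n\<close>; the else-branches are the cases \<open>a\<^sup>1\<^sub>1 = 1\<close> and \<open>a\<^sup>1\<^sub>n = \<alpha>\<^sub>n - 1\<close>.\<close>

definition kappa1 :: "nat \<Rightarrow> vec \<Rightarrow> nat" where
  "kappa1 n a = (if Poly_Mapping.lookup a 1 > 1 then 0
     else Max {k \<in> {1..n - 1}. \<forall>j\<in>{2..k}. Poly_Mapping.lookup a j = 0})"

definition kappa2 :: "nat \<Rightarrow> (nat \<Rightarrow> nat) \<Rightarrow> vec \<Rightarrow> nat" where
  "kappa2 n \<alpha> a = (if Poly_Mapping.lookup a n + 1 < \<alpha> n then n + 1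
     else Min {k \<in> {2..n}. \<forall>j\<in>{k..n - 1}. Poly_Mapping.lookup a j = \<alpha> j})"

definition distinguished_signature :: "nat \<Rightarrow> nat \<Rightarrow> nat \<Rightarrow> nat list \<Rightarrow> bool" where
  "distinguished_signature n \<kappa>\<^sub>1 \<kappa>\<^sub>2 s \<longleftrightarrow>
     (if \<kappa>\<^sub>1 + 1 < \<kappa>\<^sub>2
      then \<exists>t. length t = \<kappa>\<^sub>2 - \<kappa>\<^sub>1 - 2 \<and> s = t @ rev [\<kappa>\<^sub>2 - 1..<n] @ [1..<\<kappa>\<^sub>1 + 1]
      else s = rev [\<kappa>\<^sub>2..<n] @ [1..<\<kappa>\<^sub>1 + 1])"

definition distinguished_choice ::
    "nat \<Rightarrow> nat \<Rightarrow> (nat \<Rightarrow> nat) \<Rightarrow> (vec set set \<Rightarrow> vec set) \<Rightarrow> bool" where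
  "distinguished_choice n d \<alpha> L \<longleftrightarrow> (\<forall>A\<in>MC n d \<alpha>. let E = clique_class n d \<alpha> A; a = hd (vertices A) in
     L E \<in> E \<and> distinguished_signature n (kappa1 n a) (kappa2 n \<alpha> a) (signature n (L E)))"

text \<open>The list \<open>s\<close> with \<open>\<tau>\<^bsub>s\<^sub>i\<^esub> = k\<^sub>i\<close>.\<close>

definition relative_signature :: "nat list \<Rightarrow> nat list \<Rightarrow> nat list" where
  "relative_signature \<tau> k = (THE s. length s = length k \<and> set s \<subseteq> {1..length \<tau>} \<and>
     (\<forall>i < length k. \<tau> ! (s ! i - 1) = k ! i))"

definition first_diff_neg :: "nat list \<Rightarrow> nat list \<Rightarrow> bool" where
  "first_diff_neg s t \<longleftrightarrow> (\<exists>i < length s. s ! i < t ! i \<and> (\<forall>j < i. s ! j = t ! j))"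

text \<open>\<open>(B, A) \<in> prec\<close> means \<open>B \<prec> A\<close>.\<close>

definition rules_of_order ::
    "nat \<Rightarrow> nat \<Rightarrow> (nat \<Rightarrow> nat) \<Rightarrow> (vec set set \<Rightarrow> vec set) \<Rightarrow> vec set rel \<Rightarrow> bool" where
  "rules_of_order n d \<alpha> L prec \<longleftrightarrow>
     (\<forall>A\<in>MC n d \<alpha>. \<forall>B\<in>MC n d \<alpha>.
        clique_rank n d \<alpha> B < clique_rank n d \<alpha> A \<longrightarrow> (B, A) \<in> prec) \<and>
     (\<forall>A\<in>MC n d \<alpha>. \<forall>B\<in>MC n d \<alpha>.
        clique_rank n d \<alpha> B = clique_rank n d \<alpha> A \<and> clique_class n d \<alpha> A \<noteq> clique_class n d \<alpha> B \<and>
        (B, A) \<in> prec \<longrightarrow>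
        (\<forall>A'\<in>clique_class n d \<alpha> A. \<forall>B'\<in>clique_class n d \<alpha> B. (B', A') \<in> prec)) \<and>
     (\<forall>A\<in>MC n d \<alpha>. \<forall>B\<in>clique_class n d \<alpha> A.
        let \<tau> = signature n (L (clique_class n d \<alpha> A)) in
        (B, A) \<in> prec \<longleftrightarrow>
          first_diff_neg (relative_signature \<tau> (signature n B)) (relative_signature \<tau> (signature n A)))"

definition presentation_ideal :: "nat \<Rightarrow> nat \<Rightarrow> (nat \<Rightarrow> nat) \<Rightarrow> (vec, 'k::field) mpoly set" where
  "presentation_ideal n d \<alpha> =
     a_kernel (poly_ring (veronese_set n d \<alpha>)) (poly_ring {1..n} :: (nat, 'k) mpoly ring)
       (poly_subst monomial)"

definition sorting_binomial :: "vec \<Rightarrow> vec \<Rightarrow> (vec, 'k::field) mpoly" where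
  "sorting_binomial a b = (case sort_pair a b of (a', b') \<Rightarrow> var a * var b - var a' * var b')"

text \<open>Unsorted pairs are taken with \<open>a > b\<close>: if \<open>(a, b)\<close> is sorted and \<open>a \<noteq> b\<close>, then \<open>(b, a)\<close> is
  not, but its binomial is zero.\<close>

definition unsorted_pairs :: "nat \<Rightarrow> nat \<Rightarrow> (nat \<Rightarrow> nat) \<Rightarrow> (vec \<times> vec) set" where
  "unsorted_pairs n d \<alpha> = {(a, b). a \<in> veronese_set n d \<alpha> \<and> b \<in> veronese_set n d \<alpha> \<and>
     a > b \<and> \<not> sorted_pair a b}"

text \<open>The term orders provided by Sturmfels' theorem. The \<open>itself\<close> argument fixes the coefficient
  field.\<close>

definition sorting_term_order ::
    "nat \<Rightarrow> nat \<Rightarrow> (nat \<Rightarrow> nat) \<Rightarrow> 'k::field itself \<Rightarrow> (vec \<Rightarrow>\<^sub>0 nat) rel \<Rightarrow> bool" where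
  "sorting_term_order n d \<alpha> (_ :: 'k itself) r \<longleftrightarrow>
     term_order (veronese_set n d \<alpha>) r \<and>
     groebner_basis (veronese_set n d \<alpha>) r (presentation_ideal n d \<alpha>)
       {sorting_binomial a b :: (vec, 'k) mpoly | a b. (a, b) \<in> unsorted_pairs n d \<alpha>} \<and>
     (\<forall>(a, b) \<in> unsorted_pairs n d \<alpha>. lead_exp r (sorting_binomial a b :: (vec, 'k) mpoly) =
        Poly_Mapping.single a 1 + Poly_Mapping.single b 1)"

definition T_compl :: "nat \<Rightarrow> nat \<Rightarrow> (nat \<Rightarrow> nat) \<Rightarrow> vec set \<Rightarrow> (vec, 'k::field) mpoly" where
  "T_compl n d \<alpha> A = sqfree_mono (veronese_set n d \<alpha> - A)"

end

theory Submission
  imports Defs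
begin

text \<open>
  The idea is to record a vector \<open>a\<close> by its partial sums \<open>a\<^sub>1 + \<dots> + a\<^sub>k\<close>. Sorting a pair replaces the
  two partial sums at each \<open>k\<close> by their average, rounded up and rounded down; hence a pair is sorted
  iff the second vector arises from the first by lowering some partial sums by one
  (\<open>sorted_pair_iff_covers\<close>). A clique is therefore a chain, and a maximal one is a first vertex
  together with a permutation \<open>\<sigma>\<close> of \<open>{1..n-1}\<close>, its signature, in whose order the partial sums are
  lowered one after the other (\<open>MC_is_flag\<close>). The rank of a class is, up to a constant, the sum of the
  partial sums of the common first vertex.

  All ideals involved are monomial, so membership is divisibility. The colon ideal of \<open>A\<close> is then
  generated by variables as soon as for every \<open>B \<prec> A\<close> there are \<open>C \<prec> A\<close> and \<open>v \<notin> B\<close> with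
  \<open>A - C = {v}\<close> (\<open>linear_colon\<close>). That the complements of the maximal cliques minimally generate the
  Alexander dual holds because the faces of the initial complex are the cliques.

  Two kinds of exchange provide \<open>C\<close>. Let \<open>\<tau>\<close> be the signature of the distinguished clique of the class
  of \<open>A\<close>. Two consecutive steps of \<open>A\<close> that are out of order with respect to \<open>\<tau>\<close> (a descent) can be
  swapped, which replaces the vertex between them: the only constraints on the order of the steps
  concern neighbouring indices, and the distinguished clique obeys the same constraints
  (\<open>flag_swap\<close>). And the first vertex can be dropped in favour of a new last one, which lowers the
  rank; this is possible unless the first step is \<open>1\<close> or \<open>n - 1\<close> and the corresponding end entry has
  reached its bound (\<open>flag_rotate\<close>).

  If \<open>B \<prec> A\<close> are in one class, \<open>A\<close> must have a descent between the first place where the signatures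
  differ and the place where \<open>A\<close> makes up for it, and the vertex there is not in \<open>B\<close>. If the classes
  differ, then \<open>rank B \<le> rank A\<close>, so the first vertex of \<open>B\<close> is not above that of \<open>A\<close>; in particular
  \<open>B\<close> does not contain the latter, and if it can be exchanged, this settles the matter. Otherwise the
  first step of \<open>A\<close> is a tight index: one where the bounds on the entries force the partial sum of the
  first vertex of every maximal clique to be at least that of \<open>A\<close> (\<open>tight_minimal\<close>). The
  distinguished signature lists the tight indices last (\<open>position_tight\<close>), so \<open>A\<close> has a descent where
  it first leaves them. If \<open>B\<close> contained the vertex there, its first vertex would be above that of
  \<open>A\<close> at every index, tight or not, which was excluded.
\<close>

section \<open>Monomial ideals\<close>

lemma poly_ring_simps [simp]:
  "carrier (poly_ring V) = {p. \<forall>m\<in>Poly_Mapping.keys p. Poly_Mapping.keys m \<subseteq> V}"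
  "x \<otimes>\<^bsub>poly_ring V\<^esub> y = x * y" "x \<oplus>\<^bsub>poly_ring V\<^esub> y = x + y"
  "\<one>\<^bsub>poly_ring V\<^esub> = 1" "\<zero>\<^bsub>poly_ring V\<^esub> = 0"
  by (simp_all add: poly_ring_def)

lemma keys_plus_nat:
  fixes m k :: "'v \<Rightarrow>\<^sub>0 nat"
  shows "Poly_Mapping.keys (m + k) = Poly_Mapping.keys m \<union> Poly_Mapping.keys k"
  by (auto simp: in_keys_iff lookup_add)

lemma poly_carrier_add:
  assumes "p \<in> carrier (poly_ring V)" "q \<in> carrier (poly_ring V)"
  shows "p + q \<in> carrier (poly_ring V)"
  using assms Poly_Mapping.keys_add[of p q] by fastforce

lemma poly_carrier_mult:
  assumes "p \<in> carrier (poly_ring V)" "q \<in> carrier (poly_ring V)"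
  shows "p * q \<in> carrier (poly_ring V)"
proof -
  have "Poly_Mapping.keys m \<subseteq> V" if m: "m \<in> Poly_Mapping.keys (p * q)" for m
  proof -
    obtain a b where "m = a + b" "a \<in> Poly_Mapping.keys p" "b \<in> Poly_Mapping.keys q"
      using m keys_mult[of p q] by blast
    then show ?thesis using assms by (auto simp: keys_plus_nat)
  qed
  then show ?thesis by simp
qed

lemma cring_poly_ring: "cring (poly_ring V :: ('v, 'k::field) mpoly ring)"
proof (rule cringI)
  show "abelian_group (poly_ring V)"
  proof (rule abelian_groupI, goal_cases)
    case (1 x y)
    then show ?case using poly_carrier_add[of x V y] by (simp del: poly_ring_simps(1))
  next
    case (6 x)
    then show ?case by (intro bexI[of _ "- x"]) simp_all
  qed (simp_all add: algebra_simps)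
  show "Group.comm_monoid (poly_ring V)"
  proof (rule comm_monoidI, goal_cases)
    case (1 x y)
    then show ?case using poly_carrier_mult[of x V y] by (simp del: poly_ring_simps(1))
  qed (simp_all add: algebra_simps)
qed (simp add: algebra_simps)

lemma ring_poly_ring: "ring (poly_ring V)"
  using cring_poly_ring cring_def by blast

lemma keys_monomial [simp]: "Poly_Mapping.keys (monomial m :: ('v, 'k::field) mpoly) = {m}"
  by (simp add: monomial_def)

lemma monomial_inject [simp]: "(monomial m :: ('v, 'k::field) mpoly) = monomial m' \<longleftrightarrow> m = m'"
  by (metis keys_monomial singleton_inject)

lemma monomial_mult: "monomial m * monomial k = (monomial (m + k) :: ('v, 'k::field) mpoly)"
  by (simp add: monomial_def mult_single)

lemma poly_mapping_sum_single: "p = (\<Sum>m\<in>Poly_Mapping.keys p. Poly_Mapping.single m (Poly_Mapping.lookup p m))"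
proof (rule poly_mapping_eqI)
  fix k
  have "(\<Sum>m\<in>Poly_Mapping.keys p. Poly_Mapping.lookup (Poly_Mapping.single m (Poly_Mapping.lookup p m)) k)
      = (\<Sum>m\<in>Poly_Mapping.keys p. if m = k then Poly_Mapping.lookup p k else 0)"
    by (rule sum.cong) (auto simp: lookup_single)
  then show "Poly_Mapping.lookup p k = Poly_Mapping.lookup
      (\<Sum>m\<in>Poly_Mapping.keys p. Poly_Mapping.single m (Poly_Mapping.lookup p m)) k"
    by (simp add: lookup_sum in_keys_iff)
qed

text \<open>Membership in a monomial ideal can be tested one term at a time, because the polynomials all of
  whose terms are divisible by generators already form an ideal. This turns the ideal-theoretic
  questions below into questions about divisibility of exponents.\<close>

lemma Idl_monomials:
  assumes "\<And>m. m \<in> M \<Longrightarrow> Poly_Mapping.keys m \<subseteq> V"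
  shows "Idl\<^bsub>poly_ring V\<^esub> ((monomial :: _ \<Rightarrow> ('v, 'k::field) mpoly) ` M) =
    {p \<in> carrier (poly_ring V). \<forall>m\<in>Poly_Mapping.keys p. \<exists>m0\<in>M. \<exists>k. m = m0 + k}"
    (is "_ = ?D")
proof
  interpret R: ring "poly_ring V :: ('v, 'k) mpoly ring" by (rule ring_poly_ring)
  have gens: "(monomial :: _ \<Rightarrow> ('v, 'k) mpoly) ` M \<subseteq> carrier (poly_ring V)"
    using assms by fastforce
  have "ideal ?D (poly_ring V)"
  proof (rule idealI[OF ring_poly_ring])
    show "subgroup ?D (add_monoid (poly_ring V))"
    proof (rule R.add.subgroupI)
      have "0 \<in> ?D" by simp
      then show "?D \<noteq> {}" by blast
    next
      fix a assume a: "a \<in> ?D"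
      then have "a \<in> carrier (poly_ring V)" by simp
      moreover have "- a \<in> carrier (poly_ring V)" using a by simp
      ultimately have "\<ominus>\<^bsub>poly_ring V\<^esub> a = - a"
        by (intro R.minus_equality) simp_all
      then show "\<ominus>\<^bsub>poly_ring V\<^esub> a \<in> ?D"
        using a by simp
    next
      fix a b assume "a \<in> ?D" "b \<in> ?D"
      then show "a \<oplus>\<^bsub>poly_ring V\<^esub> b \<in> ?D"
        using Poly_Mapping.keys_add[of a b] poly_carrier_add[of a V b] by fastforce
    qed auto
  next
    fix a x :: "('v, 'k) mpoly" assume a: "a \<in> ?D" and x: "x \<in> carrier (poly_ring V)"
    have "\<exists>m0\<in>M. \<exists>k. m = m0 + k" if m: "m \<in> Poly_Mapping.keys (x * a)" for m
    proof -
      obtain u v where "m = u + v" "v \<in> Poly_Mapping.keys a"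
        using m keys_mult[of x a] by blast
      moreover obtain m0 k where "m0 \<in> M" "v = m0 + k" using a \<open>v \<in> _\<close> by blast
      ultimately have "m = m0 + (u + k)" by (simp add: algebra_simps)
      with \<open>m0 \<in> M\<close> show ?thesis by blast
    qed
    moreover have "x * a \<in> carrier (poly_ring V)" using a x by (intro poly_carrier_mult) auto
    ultimately have "x * a \<in> ?D" by simp
    then show "x \<otimes>\<^bsub>poly_ring V\<^esub> a \<in> ?D" "a \<otimes>\<^bsub>poly_ring V\<^esub> x \<in> ?D"
      by (simp_all add: mult.commute)
  qed
  moreover have "(monomial :: _ \<Rightarrow> ('v, 'k) mpoly) ` M \<subseteq> ?D"
  proof (rule image_subsetI)
    fix m assume "m \<in> M"
    then have "\<exists>m0\<in>M. \<exists>k. m = m0 + k" by (metis add.right_neutral)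
    then show "monomial m \<in> ?D" using assms[OF \<open>m \<in> M\<close>] by simp
  qed
  ultimately show "Idl\<^bsub>poly_ring V\<^esub> ((monomial :: _ \<Rightarrow> ('v, 'k) mpoly) ` M) \<subseteq> ?D"
    by (rule R.genideal_minimal)
  show "?D \<subseteq> Idl\<^bsub>poly_ring V\<^esub> ((monomial :: _ \<Rightarrow> ('v, 'k) mpoly) ` M)" (is "_ \<subseteq> ?I")
  proof
    interpret I: ideal ?I "poly_ring V :: ('v, 'k) mpoly ring"
      by (rule R.genideal_ideal[OF gens])
    fix p assume p: "p \<in> ?D"
    have "Poly_Mapping.single m (Poly_Mapping.lookup p m) \<in> ?I" if m: "m \<in> Poly_Mapping.keys p" for m
    proof -
      obtain m0 k where mk: "m0 \<in> M" "m = m0 + k" using p m by blast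
      have "monomial m0 \<in> ?I" using R.genideal_self[OF gens] mk by blast
      moreover have "Poly_Mapping.keys m \<subseteq> V" using p m by simp
      then have "Poly_Mapping.single k (Poly_Mapping.lookup p m) \<in> carrier (poly_ring V)"
        by (simp add: mk keys_plus_nat)
      ultimately have "monomial m0 * Poly_Mapping.single k (Poly_Mapping.lookup p m) \<in> ?I"
        using I.I_r_closed by force
      then show ?thesis by (simp add: monomial_def mult_single mk)
    qed
    moreover have "(\<Sum>m\<in>F. f m) \<in> ?I" if "finite F" "\<And>m. m \<in> F \<Longrightarrow> f m \<in> ?I" for F and f :: "('v \<Rightarrow>\<^sub>0 nat) \<Rightarrow> ('v, 'k) mpoly"
      using that
    proof (induction rule: finite_induct)
      case empty
      then show ?case using I.Icarr I.zero_closed by simp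
    next
      case (insert x F)
      then show ?case using I.a_closed[of "f x" "sum f F"] by simp
    qed
    ultimately show "p \<in> ?I"
      using poly_mapping_sum_single[of p] finite_keys[of p] by metis
  qed
qed

lemma monomial_in_Idl_iff:
  assumes "\<And>m. m \<in> M \<Longrightarrow> Poly_Mapping.keys m \<subseteq> V" and "Poly_Mapping.keys e \<subseteq> V"
  shows "(monomial e :: ('v, 'k::field) mpoly) \<in> Idl\<^bsub>poly_ring V\<^esub> (monomial ` M) \<longleftrightarrow>
    (\<exists>m0\<in>M. \<exists>k. e = m0 + k)"
  using assms(2) by (subst Idl_monomials[OF assms(1)]) auto

definition indicator_exp :: "'v set \<Rightarrow> ('v \<Rightarrow>\<^sub>0 nat)" where
  "indicator_exp F = (\<Sum>v\<in>F. Poly_Mapping.single v 1)"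

lemma lookup_indicator_exp:
  "finite F \<Longrightarrow> Poly_Mapping.lookup (indicator_exp F) v = of_bool (v \<in> F)"
  by (simp add: indicator_exp_def lookup_sum lookup_single when_def)

lemma keys_indicator_exp [simp]: "finite F \<Longrightarrow> Poly_Mapping.keys (indicator_exp F) = F"
  by (auto simp: in_keys_iff lookup_indicator_exp)

lemma sqfree_mono_eq: "sqfree_mono F = (monomial (indicator_exp F) :: ('v, 'k::field) mpoly)"
proof (induction F rule: infinite_finite_induct)
  case (insert x F)
  then show ?case by (simp add: sqfree_mono_def var_def monomial_mult indicator_exp_def)
qed (simp_all add: sqfree_mono_def indicator_exp_def monomial_def)

lemma indicator_exp_dvd_iff:
  assumes "finite F"
  shows "(\<exists>k. m = indicator_exp F + k) \<longleftrightarrow> F \<subseteq> Poly_Mapping.keys m"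
proof
  assume "F \<subseteq> Poly_Mapping.keys m"
  then have "m = indicator_exp F + (m - indicator_exp F)"
    using assms by (intro poly_mapping_eqI)
      (auto simp: lookup_add lookup_minus lookup_indicator_exp in_keys_iff)
  then show "\<exists>k. m = indicator_exp F + k" ..
qed (use assms in \<open>auto simp: keys_plus_nat\<close>)

lemma sqfree_mono_in_Idl_iff:
  assumes "finite V" "F \<subseteq> V" "\<And>G. G \<in> \<G> \<Longrightarrow> G \<subseteq> V"
  shows "(sqfree_mono F :: ('v, 'k::field) mpoly) \<in> Idl\<^bsub>poly_ring V\<^esub> (sqfree_mono ` \<G>) \<longleftrightarrow>
    (\<exists>G\<in>\<G>. G \<subseteq> F)"
proof -
  have fin: "finite F" "\<And>G. G \<in> \<G> \<Longrightarrow> finite G" using assms finite_subset by blast+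
  have "sqfree_mono ` \<G> = (monomial ` indicator_exp ` \<G> :: ('v, 'k) mpoly set)"
    by (simp add: image_image sqfree_mono_eq)
  moreover have "(monomial (indicator_exp F) :: ('v, 'k) mpoly) \<in>
      Idl\<^bsub>poly_ring V\<^esub> (monomial ` indicator_exp ` \<G>) \<longleftrightarrow> (\<exists>m0\<in>indicator_exp ` \<G>. \<exists>k. indicator_exp F = m0 + k)"
  proof (rule monomial_in_Idl_iff)
    show "Poly_Mapping.keys m \<subseteq> V" if m: "m \<in> indicator_exp ` \<G>" for m
      using m assms(3) fin(2) by force
  qed (use assms fin in simp)
  moreover have "(\<exists>k. indicator_exp F = indicator_exp G + k) \<longleftrightarrow> G \<subseteq> F" if "G \<in> \<G>" for G
    using indicator_exp_dvd_iff[OF fin(2)[OF that]] fin(1) by simp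
  ultimately show ?thesis by (simp add: sqfree_mono_eq)
qed

lemma Idl_sqfree_cong:
  assumes "finite V" "\<And>G. G \<in> \<G> \<Longrightarrow> G \<subseteq> V" "\<And>G. G \<in> \<H> \<Longrightarrow> G \<subseteq> V"
    and "\<And>G. G \<in> \<G> \<Longrightarrow> \<exists>H\<in>\<H>. H \<subseteq> G" "\<And>H. H \<in> \<H> \<Longrightarrow> \<exists>G\<in>\<G>. G \<subseteq> H"
  shows "Idl\<^bsub>poly_ring V\<^esub> (sqfree_mono ` \<G>) =
    (Idl\<^bsub>poly_ring V\<^esub> (sqfree_mono ` \<H>) :: ('v, 'k::field) mpoly set)"
proof -
  interpret R: ring "poly_ring V :: ('v, 'k) mpoly ring" by (rule ring_poly_ring)
  have le: "Idl\<^bsub>poly_ring V\<^esub> (sqfree_mono ` \<G>) \<subseteq>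
      (Idl\<^bsub>poly_ring V\<^esub> (sqfree_mono ` \<H>) :: ('v, 'k) mpoly set)"
    if "\<And>G. G \<in> \<G> \<Longrightarrow> G \<subseteq> V" "\<And>G. G \<in> \<H> \<Longrightarrow> G \<subseteq> V"
      "\<And>G. G \<in> \<G> \<Longrightarrow> \<exists>H\<in>\<H>. H \<subseteq> G" for \<G> \<H>
  proof (rule R.genideal_minimal)
    have "sqfree_mono ` \<H> \<subseteq> carrier (poly_ring V :: ('v, 'k) mpoly ring)"
      using that(2) finite_subset[OF _ assms(1)] by (fastforce simp: sqfree_mono_eq)
    then show "ideal (Idl\<^bsub>poly_ring V\<^esub> (sqfree_mono ` \<H>)) (poly_ring V :: ('v, 'k) mpoly ring)"
      by (rule R.genideal_ideal)
    show "sqfree_mono ` \<G> \<subseteq> (Idl\<^bsub>poly_ring V\<^esub> (sqfree_mono ` \<H>) :: ('v, 'k) mpoly set)"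
    proof
      fix x :: "('v, 'k) mpoly" assume "x \<in> sqfree_mono ` \<G>"
      then obtain G where "G \<in> \<G>" "x = sqfree_mono G" by blast
      then show "x \<in> Idl\<^bsub>poly_ring V\<^esub> (sqfree_mono ` \<H>)"
        using sqfree_mono_in_Idl_iff[OF assms(1) that(1) that(2)] that(3) by metis
    qed
  qed
  show ?thesis
    by (rule equalityI) (erule assms | rule le)+
qed

text \<open>Multiplying by a monomial translates the exponents, so a colon by a squarefree monomial can
  also be read off term by term.\<close>

lemma keys_mult_monomial:
  "Poly_Mapping.keys (p * (monomial e :: ('v, 'k::field) mpoly)) = (\<lambda>m. m + e) ` Poly_Mapping.keys p"
proof
  show "Poly_Mapping.keys (p * monomial e) \<subseteq> (\<lambda>m. m + e) ` Poly_Mapping.keys p"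
    using keys_mult[of p "monomial e"] by auto
  have "Poly_Mapping.lookup (p * monomial e) (m + e) = Poly_Mapping.lookup p m" for m
  proof -
    have "p * monomial e = (\<Sum>u\<in>Poly_Mapping.keys p. Poly_Mapping.single (u + e) (Poly_Mapping.lookup p u))"
      by (subst poly_mapping_sum_single[of p])
        (simp add: sum_distrib_right monomial_def mult_single)
    then have "Poly_Mapping.lookup (p * monomial e) (m + e) =
        (\<Sum>u\<in>Poly_Mapping.keys p. if u = m then Poly_Mapping.lookup p m else 0)"
      by (auto simp: lookup_sum lookup_single when_def intro!: sum.cong)
    then show ?thesis by (simp add: in_keys_iff)
  qed
  then show "(\<lambda>m. m + e) ` Poly_Mapping.keys p \<subseteq> Poly_Mapping.keys (p * monomial e)"
    by (auto simp: in_keys_iff)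
qed

text \<open>The combinatorial criterion for linear quotients. The complement of \<open>B\<close> divides \<open>m\<close> times the
  complement of \<open>A\<close> iff \<open>m\<close> involves all variables in \<open>A - B\<close>; and if every \<open>A - B\<close> contains some
  \<open>A - C\<close> of size one, then those singletons alone decide membership.\<close>

lemma linear_colon:
  assumes fin: "finite V" and "A \<subseteq> V" "\<And>B. B \<in> \<B> \<Longrightarrow> B \<subseteq> V"
    and exch: "\<And>B. B \<in> \<B> \<Longrightarrow> \<exists>C\<in>\<B>. \<exists>v. A - C = {v} \<and> v \<notin> B"
  shows "\<exists>S \<subseteq> V. colon_ideal (poly_ring V)
      (Idl\<^bsub>poly_ring V\<^esub> ((\<lambda>B. sqfree_mono (V - B)) ` \<B>)) (sqfree_mono (V - A) :: ('v, 'k::field) mpoly)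
    = Idl\<^bsub>poly_ring V\<^esub> (var ` S)"
proof (intro exI conjI)
  define S where "S = {v. \<exists>C\<in>\<B>. A - C = {v}}"
  show SV: "{v. \<exists>C\<in>\<B>. A - C = {v}} \<subseteq> V" using \<open>A \<subseteq> V\<close> by blast
  have finV: "finite (V - B)" for B using fin by simp
  have M: "(\<lambda>B. sqfree_mono (V - B)) ` \<B> =
      (monomial ` (\<lambda>B. indicator_exp (V - B)) ` \<B> :: ('v, 'k) mpoly set)"
    by (simp add: image_image sqfree_mono_eq)
  have N: "var ` S = (monomial ` (\<lambda>v. indicator_exp {v}) ` S :: ('v, 'k) mpoly set)"
    by (simp add: image_image var_def indicator_exp_def)
  have "(\<exists>B\<in>\<B>. V - B \<subseteq> Poly_Mapping.keys m \<union> (V - A)) \<longleftrightarrow> (\<exists>v\<in>S. v \<in> Poly_Mapping.keys m)"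
    for m :: "'v \<Rightarrow>\<^sub>0 nat"
  proof
    assume "\<exists>B\<in>\<B>. V - B \<subseteq> Poly_Mapping.keys m \<union> (V - A)"
    then obtain B where B: "B \<in> \<B>" "V - B \<subseteq> Poly_Mapping.keys m \<union> (V - A)" by blast
    obtain C v where "C \<in> \<B>" "A - C = {v}" "v \<notin> B" using exch[OF B(1)] by blast
    then show "\<exists>v\<in>S. v \<in> Poly_Mapping.keys m" using B(2) \<open>A \<subseteq> V\<close> unfolding S_def by blast
  next
    assume "\<exists>v\<in>S. v \<in> Poly_Mapping.keys m"
    then obtain C v where "C \<in> \<B>" "A - C = {v}" "v \<in> Poly_Mapping.keys m" unfolding S_def by blast
    then show "\<exists>B\<in>\<B>. V - B \<subseteq> Poly_Mapping.keys m \<union> (V - A)" by (intro bexI[of _ C]) auto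
  qed
  then have key: "(\<exists>m0\<in>(\<lambda>B. indicator_exp (V - B)) ` \<B>. \<exists>k. m + indicator_exp (V - A) = m0 + k) \<longleftrightarrow>
      (\<exists>m0\<in>(\<lambda>v. indicator_exp {v}) ` S. \<exists>k. m = m0 + k)" for m
    by (simp add: indicator_exp_dvd_iff[OF finV] indicator_exp_dvd_iff keys_plus_nat finV)
  have L: "Idl\<^bsub>poly_ring V\<^esub> ((\<lambda>B. sqfree_mono (V - B)) ` \<B>) = {p \<in> carrier (poly_ring V).
      \<forall>m\<in>Poly_Mapping.keys (p :: ('v, 'k) mpoly). \<exists>m0\<in>(\<lambda>B. indicator_exp (V - B)) ` \<B>. \<exists>k. m = m0 + k}"
    unfolding M by (rule Idl_monomials) (auto simp: finV)
  have R: "Idl\<^bsub>poly_ring V\<^esub> (var ` S) = {p \<in> carrier (poly_ring V).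
      \<forall>m\<in>Poly_Mapping.keys (p :: ('v, 'k) mpoly). \<exists>m0\<in>(\<lambda>v. indicator_exp {v}) ` S. \<exists>k. m = m0 + k}"
    unfolding N using SV[folded S_def] by (intro Idl_monomials) auto
  have "sqfree_mono (V - A) \<in> carrier (poly_ring V :: ('v, 'k) mpoly ring)"
    by (simp add: sqfree_mono_eq finV)
  then have "p * sqfree_mono (V - A) \<in> carrier (poly_ring V)"
    if "p \<in> carrier (poly_ring V :: ('v, 'k) mpoly ring)" for p
    using that poly_carrier_mult by blast
  then show "colon_ideal (poly_ring V)
      (Idl\<^bsub>poly_ring V\<^esub> ((\<lambda>B. sqfree_mono (V - B)) ` \<B>)) (sqfree_mono (V - A) :: ('v, 'k) mpoly)
    = Idl\<^bsub>poly_ring V\<^esub> (var ` {v. \<exists>C\<in>\<B>. A - C = {v}})"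
    unfolding S_def[symmetric] L R colon_ideal_def
    by (auto simp: sqfree_mono_eq keys_mult_monomial key simp del: image_iff bex_simps)
qed

section \<open>Sorting in terms of partial sums\<close>

definition psum :: "vec \<Rightarrow> nat \<Rightarrow> int" where
  "psum a k = (\<Sum>i\<in>{1..k}. int (Poly_Mapping.lookup a i))"

lemma psum_0 [simp]: "psum a 0 = 0"
  by (simp add: psum_def)

lemma psum_Suc: "psum a (Suc k) = psum a k + int (Poly_Mapping.lookup a (Suc k))"
  by (simp add: psum_def)

lemma psum_add: "psum (a + b) k = psum a k + psum b k"
  by (simp add: psum_def lookup_add sum.distrib)

lemma lookup_psum: "1 \<le> j \<Longrightarrow> int (Poly_Mapping.lookup a j) = psum a j - psum a (j - 1)"
  using psum_Suc[of a "j - 1"] by simp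

lemma psum_single: "1 \<le> s \<Longrightarrow> psum (Poly_Mapping.single s 1) k = of_bool (s \<le> k)"
proof -
  assume "1 \<le> s"
  have "psum (Poly_Mapping.single s 1) k = (\<Sum>i\<in>{1..k}. if i = s then 1 else 0)"
    unfolding psum_def by (rule sum.cong) (auto simp: lookup_single)
  then show ?thesis using \<open>1 \<le> s\<close> by simp
qed

lemma psum_inject:
  assumes "0 \<notin> Poly_Mapping.keys a" "0 \<notin> Poly_Mapping.keys b" and eq: "psum a = psum b"
  shows "a = b"
proof (rule poly_mapping_eqI)
  fix j
  show "Poly_Mapping.lookup a j = Poly_Mapping.lookup b j"
  proof (cases "j = 0")
    case True
    then show ?thesis using assms by (simp add: in_keys_iff)
  next
    case False
    then show ?thesis using lookup_psum[of j a] lookup_psum[of j b] eq by simp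
  qed
qed

lemma nths_even_odd_Cons:
  "nths (x # w) {k. even k} = x # nths w {k. odd k}"
  "nths (x # w) {k. odd k} = nths w {k. even k}"
  by (simp_all add: nths_Cons)

text \<open>In a sorted word the letters up to \<open>k\<close> form an initial segment, of which the odd-numbered
  and the even-numbered factors are the two halves. This is why sorting acts on partial sums as
  rounding the average up and down.\<close>

lemma length_filter_nths_sorted:
  assumes "sorted w"
  shows "length (filter (\<lambda>i. i \<le> k) (nths w {j. even j})) = (length (filter (\<lambda>i. i \<le> k) w) + 1) div 2"
    and "length (filter (\<lambda>i. i \<le> k) (nths w {j. odd j})) = length (filter (\<lambda>i. i \<le> k) w) div 2"
proof -
  have "length (filter (\<lambda>i. i \<le> k) (nths w {j. even j})) = (length (filter (\<lambda>i. i \<le> k) w) + 1) div 2 \<and>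
    length (filter (\<lambda>i. i \<le> k) (nths w {j. odd j})) = length (filter (\<lambda>i. i \<le> k) w) div 2"
    using assms
  proof (induction w)
    case (Cons x w)
    show ?case
    proof (cases "x \<le> k")
      case True
      then show ?thesis using Cons by (simp add: nths_even_odd_Cons)
    next
      case False
      then have none: "\<forall>y\<in>set w. \<not> y \<le> k" using Cons.prems by auto
      then have "filter (\<lambda>i. i \<le> k) w = []" "filter (\<lambda>i. i \<le> k) (nths w A) = []" for A
        using set_nths_subset[of w A] by (auto simp: filter_empty_conv)
      then show ?thesis using False by (simp add: nths_even_odd_Cons)
    qed
  qed simp
  then show "length (filter (\<lambda>i. i \<le> k) (nths w {j. even j})) = (length (filter (\<lambda>i. i \<le> k) w) + 1) div 2"
    "length (filter (\<lambda>i. i \<le> k) (nths w {j. odd j})) = length (filter (\<lambda>i. i \<le> k) w) div 2"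
    by blast+
qed

lemma sorted_concat_replicate:
  "sorted xs \<Longrightarrow> sorted (concat (map (\<lambda>i. replicate (f i) i) xs))"
  by (induction xs) (auto simp: sorted_append)

lemma sorted_index_word: "sorted (index_word c)"
  unfolding index_word_def by (intro sorted_concat_replicate) simp

lemma set_index_word: "set (index_word c) = Poly_Mapping.keys c"
  by (auto simp: index_word_def in_keys_iff)

lemma length_filter_concat_replicate:
  "distinct xs \<Longrightarrow> length (filter P (concat (map (\<lambda>i. replicate (f i) i) xs))) =
    (\<Sum>i\<in>{i \<in> set xs. P i}. f i)"
proof (induction xs)
  case (Cons x xs)
  have "{i \<in> set (x # xs). P i} = (if P x then insert x {i \<in> set xs. P i} else {i \<in> set xs. P i})"
    by auto
  then show ?case using Cons by simp
qed simp

lemma length_filter_index_word: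
  assumes "0 \<notin> Poly_Mapping.keys c"
  shows "int (length (filter (\<lambda>i. i \<le> k) (index_word c))) = psum c k"
proof -
  have "length (filter (\<lambda>i. i \<le> k) (index_word c)) =
      (\<Sum>i\<in>{i \<in> Poly_Mapping.keys c. i \<le> k}. Poly_Mapping.lookup c i)"
    unfolding index_word_def by (subst length_filter_concat_replicate) simp_all
  also have "\<dots> = (\<Sum>i\<in>{1..k}. Poly_Mapping.lookup c i)"
  proof (rule sum.mono_neutral_left)
    show "{i \<in> Poly_Mapping.keys c. i \<le> k} \<subseteq> {1..k}"
      using assms by (auto simp: Suc_le_eq intro: gr0I)
  qed (auto simp: in_keys_iff)
  finally show ?thesis by (simp add: psum_def)
qed

lemma lookup_vec_of_word: "Poly_Mapping.lookup (vec_of_word w) i = count_list w i"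
  by (induction w) (simp_all add: vec_of_word_def lookup_add lookup_single)

lemma psum_vec_of_word:
  assumes "0 \<notin> set w"
  shows "psum (vec_of_word w) k = int (length (filter (\<lambda>i. i \<le> k) w))"
  using assms
proof (induction w)
  case (Cons x w)
  have "psum (vec_of_word (x # w)) k = psum (Poly_Mapping.single x 1) k + psum (vec_of_word w) k"
    by (simp add: vec_of_word_def psum_add)
  also have "psum (Poly_Mapping.single x 1) k = of_bool (x \<le> k)"
    using Cons.prems by (intro psum_single) (auto simp: Suc_le_eq intro: gr0I)
  finally show ?case using Cons by simp
qed (simp add: vec_of_word_def psum_def)

lemma keys_vec_of_word: "Poly_Mapping.keys (vec_of_word w) = set w"
  by (auto simp: in_keys_iff lookup_vec_of_word count_list_0_iff)

lemma psum_sort_pair: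
  assumes "0 \<notin> Poly_Mapping.keys a" "0 \<notin> Poly_Mapping.keys b"
  shows "psum (fst (sort_pair a b)) k = (psum a k + psum b k + 1) div 2"
    and "psum (snd (sort_pair a b)) k = (psum a k + psum b k) div 2"
    and "0 \<notin> Poly_Mapping.keys (fst (sort_pair a b))"
    and "0 \<notin> Poly_Mapping.keys (snd (sort_pair a b))"
proof -
  define w where "w = index_word (a + b)"
  have 0: "0 \<notin> Poly_Mapping.keys (a + b)" using assms by (simp add: keys_plus_nat)
  have sub: "set (nths w A) \<subseteq> Poly_Mapping.keys (a + b)" for A
    using set_nths_subset[of w A] by (simp add: w_def set_index_word)
  have eq: "sort_pair a b = (vec_of_word (nths w {k. even k}), vec_of_word (nths w {k. odd k}))"
    by (simp add: sort_pair_def w_def Let_def)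
  have w: "int (length (filter (\<lambda>i. i \<le> k) w)) = psum a k + psum b k"
    using length_filter_index_word[OF 0] by (simp add: w_def psum_add)
  have srt: "sorted w" by (simp add: w_def sorted_index_word)
  show "0 \<notin> Poly_Mapping.keys (fst (sort_pair a b))" "0 \<notin> Poly_Mapping.keys (snd (sort_pair a b))"
    using sub 0 by (auto simp: eq keys_vec_of_word)
  have half: "psum (vec_of_word (nths w A)) k = int (length (filter (\<lambda>i. i \<le> k) (nths w A)))" for A
    by (rule psum_vec_of_word) (meson 0 sub subsetD)
  show "psum (fst (sort_pair a b)) k = (psum a k + psum b k + 1) div 2"
    unfolding eq fst_conv half length_filter_nths_sorted(1)[OF srt] w[symmetric] by (simp add: zdiv_int)
  show "psum (snd (sort_pair a b)) k = (psum a k + psum b k) div 2"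
    unfolding eq snd_conv half length_filter_nths_sorted(2)[OF srt] w[symmetric] by (simp add: zdiv_int)
qed

text \<open>This will turn out to be the relation of being a sorted pair.\<close>

definition covers :: "vec \<Rightarrow> vec \<Rightarrow> bool" where
  "covers a b \<longleftrightarrow> (\<forall>k. psum b k \<le> psum a k \<and> psum a k \<le> psum b k + 1)"

text \<open>Rounding the average of two integers up and down returns the same two integers, in the same
  order, iff the first is the second or its successor.\<close>

lemma sorted_pair_iff_covers:
  assumes "0 \<notin> Poly_Mapping.keys a" "0 \<notin> Poly_Mapping.keys b"
  shows "sorted_pair a b \<longleftrightarrow> covers a b"
proof -
  have "sorted_pair a b \<longleftrightarrow> fst (sort_pair a b) = a \<and> snd (sort_pair a b) = b"
    by (auto simp: sorted_pair_def prod_eq_iff)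
  also have "\<dots> \<longleftrightarrow> psum (fst (sort_pair a b)) = psum a \<and> psum (snd (sort_pair a b)) = psum b"
    by (metis assms psum_inject psum_sort_pair(3,4))
  also have "\<dots> \<longleftrightarrow> (\<forall>k. (psum a k + psum b k + 1) div 2 = psum a k \<and> (psum a k + psum b k) div 2 = psum b k)"
    by (auto simp: fun_eq_iff psum_sort_pair(1,2)[OF assms])
  also have "\<dots> \<longleftrightarrow> covers a b"
  proof -
    have "((x + y + 1) div 2 = x \<and> (x + y) div 2 = y) \<longleftrightarrow> y \<le> x \<and> x \<le> y + 1" for x y :: int
      by presburger
    then show ?thesis by (simp add: covers_def)
  qed
  finally show ?thesis .
qed

lemma covers_refl [simp]: "covers a a"
  by (simp add: covers_def)

text \<open>At the first index where the partial sums differ, so do the entries, and in the same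
  direction. Thus the lexicographic order in the definition of the edges merely orients them.\<close>

lemma covers_less:
  assumes "0 \<notin> Poly_Mapping.keys a" "0 \<notin> Poly_Mapping.keys b" "covers a b" "a \<noteq> b"
  shows "b < a"
proof -
  define k where "k = (LEAST k. psum a k \<noteq> psum b k)"
  have "\<exists>k. psum a k \<noteq> psum b k" using psum_inject[OF assms(1,2)] assms(4) by auto
  then have k: "psum a k \<noteq> psum b k" unfolding k_def by (rule LeastI_ex)
  have below: "psum a j = psum b j" if "j < k" for j
    using not_less_Least[of j "\<lambda>k. psum a k \<noteq> psum b k"] that unfolding k_def by blast
  have "k \<noteq> 0" using k by (intro notI) simp
  have eq: "Poly_Mapping.lookup b j = Poly_Mapping.lookup a j" if "j < k" for j
  proof (cases "j = 0")
    case True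
    then show ?thesis using assms by (simp add: in_keys_iff)
  next
    case False
    then show ?thesis using lookup_psum[of j a] lookup_psum[of j b] below[of j] below[of "j - 1"] that
      by simp
  qed
  moreover have "psum b k < psum a k" using k assms(3) by (simp add: covers_def order_less_le)
  then have "Poly_Mapping.lookup b k < Poly_Mapping.lookup a k"
    using lookup_psum[of k a] lookup_psum[of k b] below[of "k - 1"] \<open>k \<noteq> 0\<close> by simp
  ultimately show ?thesis
    by (auto simp: less_poly_mapping.rep_eq less_fun_def)
qed

lemma veronese_0: "a \<in> veronese_set n d \<alpha> \<Longrightarrow> 0 \<notin> Poly_Mapping.keys a"
  by (auto simp: veronese_set_def)

lemma sorting_edge_iff:
  "{a, b} \<in> sorting_edges n d \<alpha> \<longleftrightarrow>
    a \<in> veronese_set n d \<alpha> \<and> b \<in> veronese_set n d \<alpha> \<and> a \<noteq> b \<and> (covers a b \<or> covers b a)"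
    (is "?L \<longleftrightarrow> ?R")
proof
  assume ?L
  then obtain x y where "{a, b} = {x, y}" "x \<in> veronese_set n d \<alpha>" "y \<in> veronese_set n d \<alpha>"
    "x > y" "sorted_pair x y"
    unfolding sorting_edges_def by blast
  moreover from this have "covers x y" using sorted_pair_iff_covers[OF veronese_0 veronese_0] by simp
  ultimately show ?R by (auto simp: doubleton_eq_iff)
next
  assume R: ?R
  have *: "{x, y} \<in> sorting_edges n d \<alpha>"
    if "x \<in> veronese_set n d \<alpha>" "y \<in> veronese_set n d \<alpha>" "x \<noteq> y" "covers x y" for x y
  proof -
    have "y < x" "sorted_pair x y"
      using that covers_less[OF veronese_0 veronese_0] sorted_pair_iff_covers[OF veronese_0 veronese_0]
      by simp_all
    then show ?thesis using that unfolding sorting_edges_def by blast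
  qed
  show ?L using R *[of a b] *[of b a] by (auto simp: insert_commute)
qed

lemma clique_iff_covers:
  "clique n d \<alpha> A \<longleftrightarrow> A \<subseteq> veronese_set n d \<alpha> \<and> (\<forall>a\<in>A. \<forall>b\<in>A. covers a b \<or> covers b a)"
proof -
  have "(a \<noteq> b \<longrightarrow> a \<in> V \<and> b \<in> V \<and> a \<noteq> b \<and> (covers a b \<or> covers b a)) \<longleftrightarrow> covers a b \<or> covers b a"
    if "A \<subseteq> V" "a \<in> A" "b \<in> A" for a b V
    using that by (cases "a = b") auto
  then show ?thesis unfolding clique_def sorting_edge_iff by (metis (no_types, lifting))
qed

section \<open>The Alexander dual\<close>

lemma finite_veronese_set: "finite (veronese_set n d \<alpha>)"
proof (rule finite_imageD)
  let ?f = "\<lambda>a. restrict (Poly_Mapping.lookup a) {1..n}"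
  have "?f a \<in> {1..n} \<rightarrow>\<^sub>E {..d}" if "a \<in> veronese_set n d \<alpha>" for a
  proof -
    have "Poly_Mapping.lookup a i \<le> d" if "i \<in> {1..n}" for i
      using that \<open>a \<in> _\<close> member_le_sum[of i "{1..n}" "Poly_Mapping.lookup a"]
      by (simp add: veronese_set_def)
    then show ?thesis by auto
  qed
  then have "?f ` veronese_set n d \<alpha> \<subseteq> {1..n} \<rightarrow>\<^sub>E {..d}" by blast
  then show "finite (?f ` veronese_set n d \<alpha>)"
    by (rule finite_subset) (simp add: finite_PiE)
  show "inj_on ?f (veronese_set n d \<alpha>)"
  proof (rule inj_onI, rule poly_mapping_eqI)
    fix a b i assume ab: "a \<in> veronese_set n d \<alpha>" "b \<in> veronese_set n d \<alpha>" "?f a = ?f b"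
    show "Poly_Mapping.lookup a i = Poly_Mapping.lookup b i"
    proof (cases "i \<in> {1..n}")
      case True
      then show ?thesis using fun_cong[OF ab(3), of i] by simp
    next
      case False
      then have "i \<notin> Poly_Mapping.keys a" "i \<notin> Poly_Mapping.keys b"
        using ab(1,2) unfolding veronese_set_def by blast+
      then show ?thesis by (simp add: in_keys_iff)
    qed
  qed
qed

lemma clique_iff_no_unsorted:
  assumes "F \<subseteq> veronese_set n d \<alpha>"
  shows "clique n d \<alpha> F \<longleftrightarrow> (\<forall>(a, b)\<in>unsorted_pairs n d \<alpha>. \<not> {a, b} \<subseteq> F)"
proof
  assume F: "clique n d \<alpha> F"
  have False if "(a, b) \<in> unsorted_pairs n d \<alpha>" "a \<in> F" "b \<in> F" for a b
  proof -
    have ab: "0 \<notin> Poly_Mapping.keys a" "0 \<notin> Poly_Mapping.keys b" "b < a" "\<not> sorted_pair a b"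
      using that(1) by (auto simp: unsorted_pairs_def dest: veronese_0)
    then have "covers b a" using F that(2,3) sorted_pair_iff_covers[of a b]
      by (auto simp: clique_iff_covers)
    then show False using covers_less[of b a] ab by (metis less_asym less_irrefl)
  qed
  then show "\<forall>(a, b)\<in>unsorted_pairs n d \<alpha>. \<not> {a, b} \<subseteq> F" by auto
next
  assume none: "\<forall>(a, b)\<in>unsorted_pairs n d \<alpha>. \<not> {a, b} \<subseteq> F"
  have *: "covers a b" if "a \<in> F" "b \<in> F" "b < a" for a b
  proof -
    have V: "a \<in> veronese_set n d \<alpha>" "b \<in> veronese_set n d \<alpha>" using that assms by auto
    then have "sorted_pair a b" using none that by (auto simp: unsorted_pairs_def)
    then show ?thesis using sorted_pair_iff_covers[of a b] V veronese_0 by simp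
  qed
  have "covers a b \<or> covers b a" if "a \<in> F" "b \<in> F" for a b
    using that *[of a b] *[of b a] by (cases a b rule: linorder_cases) auto
  then show "clique n d \<alpha> F" using assms by (simp add: clique_iff_covers)
qed

lemma single_add_single_eq_indicator:
  "a \<noteq> b \<Longrightarrow> Poly_Mapping.single a 1 + Poly_Mapping.single b 1 = indicator_exp {a, b}"
  by (simp add: indicator_exp_def)

text \<open>The binomial of a pair vanishes only if sorting merely swaps the pair. As the first component
  of a sorted pair has the larger partial sums, this is excluded by \<open>b < a\<close>.\<close>

lemma sorting_binomial_nonzero:
  assumes "(a, b) \<in> unsorted_pairs n d \<alpha>"
  shows "(sorting_binomial a b :: (vec, 'k::field) mpoly) \<noteq> 0"
proof
  assume zero: "(sorting_binomial a b :: (vec, 'k) mpoly) = 0"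
  have a0: "0 \<notin> Poly_Mapping.keys a" and b0: "0 \<notin> Poly_Mapping.keys b" and "b < a"
    and uns: "\<not> sorted_pair a b"
    using assms by (auto simp: unsorted_pairs_def dest: veronese_0)
  obtain a' b' where s: "sort_pair a b = (a', b')" by fastforce
  have "(var a * var b :: (vec, 'k) mpoly) = var a' * var b'"
    using zero by (simp add: sorting_binomial_def s)
  then have eq: "Poly_Mapping.single a (1::nat) + Poly_Mapping.single b 1 =
      Poly_Mapping.single a' 1 + Poly_Mapping.single b' 1"
    by (simp add: var_def monomial_mult)
  have "{a, b} = {a', b'}"
    using arg_cong[OF eq, of Poly_Mapping.keys] by (simp add: keys_plus_nat insert_commute)
  then have "a' = b \<and> b' = a"
    using uns s by (auto simp: sorted_pair_def doubleton_eq_iff)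
  have "psum a k \<le> psum b k \<and> psum b k \<le> psum a k + 1" for k
  proof -
    have "psum b k = (psum a k + psum b k + 1) div 2" "psum a k = (psum a k + psum b k) div 2"
      using psum_sort_pair(1,2)[OF a0 b0, of k] \<open>a' = b \<and> b' = a\<close> by (simp_all add: s)
    then show ?thesis by presburger
  qed
  then have "covers b a" by (simp add: covers_def)
  then show False using covers_less[OF b0 a0] \<open>b < a\<close> by (metis less_asym less_irrefl)
qed

lemma initial_ideal_eq:
  assumes "sorting_term_order n d \<alpha> TYPE('k::field) r"
  shows "initial_ideal (veronese_set n d \<alpha>) r (presentation_ideal n d \<alpha>) =
    (Idl\<^bsub>poly_ring (veronese_set n d \<alpha>)\<^esub> (sqfree_mono ` {{a, b} | a b. (a, b) \<in> unsorted_pairs n d \<alpha>})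
      :: (vec, 'k) mpoly set)"
proof -
  let ?G = "{sorting_binomial a b :: (vec, 'k) mpoly | a b. (a, b) \<in> unsorted_pairs n d \<alpha>}"
  have lead: "(monomial (lead_exp r (sorting_binomial a b :: (vec, 'k) mpoly)) :: (vec, 'k) mpoly) = sqfree_mono {a, b}"
    if "(a, b) \<in> unsorted_pairs n d \<alpha>" for a b
  proof -
    have "a \<noteq> b" using that by (auto simp: unsorted_pairs_def)
    then have "lead_exp r (sorting_binomial a b :: (vec, 'k) mpoly) = indicator_exp {a, b}"
      using assms that single_add_single_eq_indicator[of a b]
      unfolding sorting_term_order_def by fastforce
    then show ?thesis by (simp add: sqfree_mono_eq)
  qed
  have "{monomial (lead_exp r p) | p. p \<in> ?G \<and> p \<noteq> 0} =
      (\<lambda>(a, b). monomial (lead_exp r (sorting_binomial a b :: (vec, 'k) mpoly)) :: (vec, 'k) mpoly) ` unsorted_pairs n d \<alpha>"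
    using sorting_binomial_nonzero by fastforce
  also have "\<dots> = (\<lambda>(a, b). sqfree_mono {a, b}) ` unsorted_pairs n d \<alpha>"
    by (rule image_cong) (auto simp: lead)
  also have "\<dots> = sqfree_mono ` {{a, b} | a b. (a, b) \<in> unsorted_pairs n d \<alpha>}"
    by (auto simp: image_iff)
  finally show ?thesis
    using assms by (simp add: sorting_term_order_def groebner_basis_def)
qed

lemma clique_subset_MC:
  assumes "clique n d \<alpha> C"
  shows "\<exists>A\<in>MC n d \<alpha>. C \<subseteq> A"
proof -
  have "{A. clique n d \<alpha> A} \<subseteq> Pow (veronese_set n d \<alpha>)" by (auto simp: clique_iff_covers)
  then have "finite {A. clique n d \<alpha> A}"
    by (rule finite_subset) (simp add: finite_veronese_set)
  then obtain A where "clique n d \<alpha> A" "C \<subseteq> A" "\<forall>B\<in>{A. clique n d \<alpha> A}. A \<subseteq> B \<longrightarrow> A = B"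
    using finite_has_maximal2[of "{A. clique n d \<alpha> A}" C] assms by auto
  then have "A \<in> MC n d \<alpha>" by (auto simp: MC_def)
  with \<open>C \<subseteq> A\<close> show ?thesis by blast
qed

lemma MC_subset: "A \<in> MC n d \<alpha> \<Longrightarrow> A \<subseteq> veronese_set n d \<alpha>"
  by (simp add: MC_def clique_def)

lemma MC_antichain: "A \<in> MC n d \<alpha> \<Longrightarrow> B \<in> MC n d \<alpha> \<Longrightarrow> A \<subseteq> B \<Longrightarrow> A = B"
  by (auto simp: MC_def)

text \<open>A set of vertices spans a face of the initial complex iff it is a clique; so the Alexander
  dual is generated by the complements of cliques, and the complements of the maximal ones suffice.\<close>

lemma alexander_dual_eq:
  assumes "sorting_term_order n d \<alpha> TYPE('k::field) r"
  defines "V \<equiv> veronese_set n d \<alpha>"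
  shows "alexander_dual V (initial_ideal V r (presentation_ideal n d \<alpha>)) =
    (Idl\<^bsub>poly_ring V\<^esub> (sqfree_mono ` (\<lambda>A. V - A) ` MC n d \<alpha>) :: (vec, 'k) mpoly set)"
proof -
  let ?E = "{{a, b} | a b. (a, b) \<in> unsorted_pairs n d \<alpha>}"
  let ?I = "initial_ideal V r (presentation_ideal n d \<alpha>) :: (vec, 'k) mpoly set"
  have finV: "finite V" by (simp add: V_def finite_veronese_set)
  have "(sqfree_mono F :: (vec, 'k) mpoly) \<in> ?I \<longleftrightarrow> \<not> clique n d \<alpha> F" if F: "F \<subseteq> V" for F
  proof -
    have "(sqfree_mono F :: (vec, 'k) mpoly) \<in> ?I \<longleftrightarrow> (\<exists>G\<in>?E. G \<subseteq> F)"
      unfolding V_def initial_ideal_eq[OF assms(1)]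
      using F finV by (intro sqfree_mono_in_Idl_iff) (auto simp: V_def unsorted_pairs_def)
    also have "\<dots> \<longleftrightarrow> \<not> (\<forall>(a, b)\<in>unsorted_pairs n d \<alpha>. \<not> {a, b} \<subseteq> F)"
      unfolding Bex_def mem_Collect_eq by (metis (mono_tags, lifting) case_prod_conv old.prod.exhaust)
    finally show ?thesis using clique_iff_no_unsorted[of F n d \<alpha>] F by (simp add: V_def)
  qed
  then have "sr_complex V ?I = {F. clique n d \<alpha> F}"
    unfolding sr_complex_def V_def by (intro Collect_cong) (metis clique_def)
  moreover have "{sqfree_mono F | F. F \<subseteq> V \<and> F \<notin> dual_complex V {F. clique n d \<alpha> F}} =
      (sqfree_mono ` {F. F \<subseteq> V \<and> clique n d \<alpha> (V - F)} :: (vec, 'k) mpoly set)"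
  proof -
    have "F \<in> dual_complex V {F. clique n d \<alpha> F} \<longleftrightarrow> \<not> clique n d \<alpha> (V - F)" if "F \<subseteq> V" for F
    proof -
      have "F = V - (V - F)" using that by blast
      moreover have "V - (V - G) = G" if "G \<subseteq> V" for G using that by blast
      ultimately show ?thesis unfolding dual_complex_def by auto
    qed
    then show ?thesis by (auto simp: image_iff)
  qed
  moreover have "Idl\<^bsub>poly_ring V\<^esub> (sqfree_mono ` {F. F \<subseteq> V \<and> clique n d \<alpha> (V - F)}) =
      (Idl\<^bsub>poly_ring V\<^esub> (sqfree_mono ` (\<lambda>A. V - A) ` MC n d \<alpha>) :: (vec, 'k) mpoly set)"
  proof (rule Idl_sqfree_cong[OF finV])
    fix G assume G: "G \<in> {F. F \<subseteq> V \<and> clique n d \<alpha> (V - F)}"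
    then obtain A where "A \<in> MC n d \<alpha>" "V - G \<subseteq> A" using clique_subset_MC by blast
    then have "V - A \<in> (\<lambda>A. V - A) ` MC n d \<alpha>" "V - A \<subseteq> G" by blast+
    then show "\<exists>H\<in>(\<lambda>A. V - A) ` MC n d \<alpha>. H \<subseteq> G" by blast
  next
    fix H assume "H \<in> (\<lambda>A. V - A) ` MC n d \<alpha>"
    then obtain A where A: "A \<in> MC n d \<alpha>" "H = V - A" by blast
    then have "V - H = A" using MC_subset[of A n d \<alpha>] by (auto simp: V_def)
    then have "H \<in> {F. F \<subseteq> V \<and> clique n d \<alpha> (V - F)}" using A by (auto simp: MC_def)
    then show "\<exists>G\<in>{F. F \<subseteq> V \<and> clique n d \<alpha> (V - F)}. G \<subseteq> H" by blast
  qed auto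
  ultimately show ?thesis by (simp add: alexander_dual_def sr_ideal_def)
qed

lemma T_compl_image:
  "{T_compl n d \<alpha> A :: (vec, 'k::field) mpoly | A. A \<in> \<B>} = sqfree_mono ` (\<lambda>A. veronese_set n d \<alpha> - A) ` \<B>"
  by (auto simp: T_compl_def)

lemma alexander_dual_minimal_generators:
  assumes "sorting_term_order n d \<alpha> TYPE('k::field) r"
  shows "minimal_monomial_generating_set (veronese_set n d \<alpha>)
      (alexander_dual (veronese_set n d \<alpha>)
        (initial_ideal (veronese_set n d \<alpha>) r (presentation_ideal n d \<alpha>)))
      {T_compl n d \<alpha> A :: (vec, 'k) mpoly | A. A \<in> MC n d \<alpha>}"
proof -
  define V where "V = veronese_set n d \<alpha>"
  let ?G = "sqfree_mono ` (\<lambda>A. V - A) ` MC n d \<alpha> :: (vec, 'k) mpoly set"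
  have finV: "finite V" by (simp add: V_def finite_veronese_set)
  have "?G \<subseteq> {monomial m | m. Poly_Mapping.keys m \<subseteq> V}"
    using finV by (auto simp: sqfree_mono_eq)
  moreover have "Idl\<^bsub>poly_ring V\<^esub> G' \<noteq> Idl\<^bsub>poly_ring V\<^esub> ?G" if G': "G' \<subset> ?G" for G'
  proof
    assume eq: "Idl\<^bsub>poly_ring V\<^esub> G' = Idl\<^bsub>poly_ring V\<^esub> ?G"
    define \<B> where "\<B> = {A \<in> MC n d \<alpha>. sqfree_mono (V - A) \<in> G'}"
    have G'_eq: "G' = sqfree_mono ` (\<lambda>A. V - A) ` \<B>" using G' unfolding \<B>_def by blast
    obtain A where A: "A \<in> MC n d \<alpha>" "(sqfree_mono (V - A) :: (vec, 'k) mpoly) \<notin> G'"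
      using G' by blast
    have "(sqfree_mono (V - A) :: (vec, 'k) mpoly) \<in> Idl\<^bsub>poly_ring V\<^esub> ?G"
    proof (subst sqfree_mono_in_Idl_iff[OF finV])
      show "\<exists>G\<in>(\<lambda>A. V - A) ` MC n d \<alpha>. G \<subseteq> V - A" using A by blast
    qed auto
    then have "(sqfree_mono (V - A) :: (vec, 'k) mpoly) \<in> Idl\<^bsub>poly_ring V\<^esub> (sqfree_mono ` (\<lambda>A. V - A) ` \<B>)"
      using eq unfolding G'_eq by simp
    then have "\<exists>G\<in>(\<lambda>A. V - A) ` \<B>. G \<subseteq> V - A"
      by (subst (asm) sqfree_mono_in_Idl_iff[OF finV]) auto
    then obtain B where B: "B \<in> \<B>" "V - B \<subseteq> V - A" by blast
    then have "A \<subseteq> B" using MC_subset[OF A(1)] unfolding V_def by blast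
    then have "A = B" using MC_antichain A(1) B(1) unfolding \<B>_def by blast
    then show False using A(2) B(1) unfolding \<B>_def by blast
  qed
  ultimately show ?thesis
    unfolding minimal_monomial_generating_set_def T_compl_image V_def[symmetric]
      alexander_dual_eq[OF assms, folded V_def] by blast
qed

section \<open>Maximal cliques as flags\<close>

text \<open>These are the partial sums of the elements of \<open>veronese_set n d \<alpha>\<close>, continued constantly beyond
  \<open>n\<close>.\<close>

definition admissible :: "nat \<Rightarrow> nat \<Rightarrow> (nat \<Rightarrow> nat) \<Rightarrow> (nat \<Rightarrow> int) \<Rightarrow> bool" where
  "admissible n d \<alpha> f \<longleftrightarrow> f 0 = 0 \<and> (\<forall>k\<ge>n. f k = int d) \<and>
     (\<forall>j\<in>{1..n}. f (j - 1) \<le> f j \<and> f j \<le> f (j - 1) + int (\<alpha> j))"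

lemma admissible_psum:
  assumes "a \<in> veronese_set n d \<alpha>"
  shows "admissible n d \<alpha> (psum a)"
proof -
  have "psum a k = int d" if "k \<ge> n" for k
  proof -
    have "Poly_Mapping.lookup a i = 0" if "i \<notin> {1..n}" for i
      using assms that by (force simp: veronese_set_def in_keys_iff)
    then have "(\<Sum>i\<in>{1..k}. Poly_Mapping.lookup a i) = (\<Sum>i\<in>{1..n}. Poly_Mapping.lookup a i)"
      using that by (intro sum.mono_neutral_right) auto
    then show ?thesis using assms by (simp add: psum_def veronese_set_def flip: of_nat_sum)
  qed
  moreover have "psum a (j - 1) \<le> psum a j \<and> psum a j \<le> psum a (j - 1) + int (\<alpha> j)" if "j \<in> {1..n}" for j
  proof -
    have "Poly_Mapping.lookup a j \<le> \<alpha> j" using assms that by (simp add: veronese_set_def)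
    then show ?thesis using lookup_psum[of j a] that by simp
  qed
  ultimately show ?thesis by (simp add: admissible_def)
qed

lemma admissible_psum_ex:
  assumes "admissible n d \<alpha> f"
  obtains a where "a \<in> veronese_set n d \<alpha>" "psum a = f"
proof -
  define g where "g = (\<lambda>j. if j \<in> {1..n} then nat (f j - f (j - 1)) else 0)"
  define a where "a = Poly_Mapping.Abs_poly_mapping g"
  have "finite {j. g j \<noteq> 0}"
    by (rule finite_subset[of _ "{1..n}"]) (auto simp: g_def)
  then have look: "Poly_Mapping.lookup a = g" by (simp add: a_def)
  have f: "f 0 = 0" "\<And>k. k \<ge> n \<Longrightarrow> f k = int d"
    "\<And>j. j \<in> {1..n} \<Longrightarrow> f (j - 1) \<le> f j \<and> f j \<le> f (j - 1) + int (\<alpha> j)"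
    using assms by (auto simp: admissible_def)
  have step: "int (g (Suc k)) = f (Suc k) - f k" for k
    using f(2)[of k] f(2)[of "Suc k"] f(3)[of "Suc k"] by (cases "Suc k \<le> n") (auto simp: g_def)
  have eq: "psum a k = f k" for k
    by (induction k) (simp_all add: f psum_Suc look step)
  have "Poly_Mapping.keys a \<subseteq> {1..n}" by (auto simp: in_keys_iff look g_def split: if_splits)
  moreover have "int (\<Sum>i\<in>{1..n}. Poly_Mapping.lookup a i) = int d"
    using eq[of n] f(2)[of n] by (simp add: psum_def)
  then have "(\<Sum>i\<in>{1..n}. Poly_Mapping.lookup a i) = d" by (simp only: of_nat_eq_iff)
  moreover have "Poly_Mapping.lookup a i \<le> \<alpha> i" if "i \<in> {1..n}" for i
    using f(3)[OF that] that by (auto simp: look g_def)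
  ultimately have "a \<in> veronese_set n d \<alpha>" by (simp add: veronese_set_def)
  moreover have "psum a = f" using eq by blast
  ultimately show thesis by (rule that)
qed

definition lower :: "(nat \<Rightarrow> int) \<Rightarrow> nat set \<Rightarrow> nat \<Rightarrow> int" where
  "lower f U k = f k - of_bool (k \<in> U)"

lemma lower_empty [simp]: "lower f {} = f"
  by (simp add: lower_def fun_eq_iff)

lemma lower_lower: "U \<inter> W = {} \<Longrightarrow> lower (lower f U) W = lower f (U \<union> W)"
  by (auto simp: lower_def fun_eq_iff)

lemma lower_inject: "lower f U = lower f W \<longleftrightarrow> U = W"
proof
  assume eq: "lower f U = lower f W"
  have "k \<in> U \<longleftrightarrow> k \<in> W" for k using fun_cong[OF eq, of k] by (auto simp: lower_def of_bool_def split: if_splits)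
  then show "U = W" by blast
qed simp

lemma covers_iff_lower: "covers a b \<longleftrightarrow> (\<exists>U. psum b = lower (psum a) U)"
proof
  assume c: "covers a b"
  have "psum b k = lower (psum a) {k. psum b k \<noteq> psum a k} k" for k
    using c[unfolded covers_def, rule_format, of k] by (simp add: lower_def)
  then show "\<exists>U. psum b = lower (psum a) U" by blast
qed (auto simp: covers_def lower_def)

lemma covers_of_lower:
  "psum a = lower f U \<Longrightarrow> psum b = lower f W \<Longrightarrow> U \<subseteq> W \<Longrightarrow> covers a b"
  by (auto simp: covers_def lower_def)

lemma psum_step_iff:
  assumes "0 \<notin> Poly_Mapping.keys a" "0 \<notin> Poly_Mapping.keys b" "1 \<le> s"
  shows "b + Poly_Mapping.single s 1 = a + Poly_Mapping.single (s + 1) 1 \<longleftrightarrow> psum b = lower (psum a) {s}"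
proof -
  have "b + Poly_Mapping.single s 1 = a + Poly_Mapping.single (s + 1) 1 \<longleftrightarrow>
      psum (b + Poly_Mapping.single s 1) = psum (a + Poly_Mapping.single (s + 1) 1)"
    using assms psum_inject[of "b + Poly_Mapping.single s 1" "a + Poly_Mapping.single (s + 1) 1"]
    by (auto simp: keys_plus_nat)
  also have "\<dots> \<longleftrightarrow> (\<forall>k. psum b k + of_bool (s \<le> k) = psum a k + of_bool (s + 1 \<le> k))"
    using assms(3) by (simp only: fun_eq_iff psum_add psum_single)
  also have "\<dots> \<longleftrightarrow> psum b = lower (psum a) {s}"
  proof -
    have "x + of_bool (s \<le> k) = y + of_bool (s + 1 \<le> k) \<longleftrightarrow> x = y - of_bool (k \<in> {s})" for x y :: int and k
      by auto
    then show ?thesis by (simp only: fun_eq_iff lower_def)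
  qed
  finally show ?thesis .
qed

lemma admissible_lower_single:
  assumes "admissible n d \<alpha> f" "s \<in> {1..<n}" "f (s - 1) < f s" "f (s + 1) < f s + int (\<alpha> (s + 1))"
  shows "admissible n d \<alpha> (lower f {s})"
proof -
  have "lower f {s} (j - 1) \<le> lower f {s} j \<and> lower f {s} j \<le> lower f {s} (j - 1) + int (\<alpha> j)"
    if j: "j \<in> {1..n}" for j
  proof -
    have "f (j - 1) \<le> f j \<and> f j \<le> f (j - 1) + int (\<alpha> j)" using assms(1) j by (simp add: admissible_def)
    then show ?thesis using assms(2-) j by (cases "j = s"; cases "j = s + 1") (auto simp: lower_def)
  qed
  then show ?thesis using assms(1,2) by (auto simp: admissible_def lower_def)
qed

definition raise :: "(nat \<Rightarrow> int) \<Rightarrow> nat \<Rightarrow> nat \<Rightarrow> int" where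
  "raise f r = f(r := f r + 1)"

lemma admissible_raise:
  assumes "admissible n d \<alpha> f" "r \<in> {1..<n}" "f r < f (r - 1) + int (\<alpha> r)" "f r < f (r + 1)"
  shows "admissible n d \<alpha> (raise f r)"
proof -
  have "raise f r (j - 1) \<le> raise f r j \<and> raise f r j \<le> raise f r (j - 1) + int (\<alpha> j)"
    if j: "j \<in> {1..n}" for j
  proof -
    have "f (j - 1) \<le> f j \<and> f j \<le> f (j - 1) + int (\<alpha> j)" using assms(1) j by (simp add: admissible_def)
    then show ?thesis using assms(2-) j by (cases "j = r"; cases "j = r + 1") (auto simp: raise_def)
  qed
  then show ?thesis using assms(1,2) by (auto simp: admissible_def raise_def)
qed

text \<open>A gap in a chain can be refined by a single step. Search \<open>S\<close> upwards from its least element;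
  lowering the current \<open>s\<close> never makes entry \<open>s\<close> negative. If it makes entry \<open>s + 1\<close> too large, that
  entry is full; then \<open>s + 1\<close> must lie in \<open>S\<close>, and as its entry is positive, the search continues
  there.\<close>

lemma admissible_interpolate:
  assumes f: "admissible n d \<alpha> f" and g: "admissible n d \<alpha> (lower f S)"
    and \<alpha>: "\<And>i. i \<in> {1..n} \<Longrightarrow> 1 \<le> \<alpha> i" and S: "S \<subseteq> {1..<n}" "S \<noteq> {}"
  shows "\<exists>s\<in>S. admissible n d \<alpha> (lower f {s})"
proof (rule ccontr)
  assume no: "\<not> ?thesis"
  then have blocked: "\<not> (f (s - 1) < f s \<and> f (s + 1) < f s + int (\<alpha> (s + 1)))" if "s \<in> S" for s
    using that no S(1) admissible_lower_single[OF f, of s] by blast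
  have gj: "lower f S (j - 1) \<le> lower f S j \<and> lower f S j \<le> lower f S (j - 1) + int (\<alpha> j)"
    if "j \<in> {1..n}" for j using g that by (simp add: admissible_def)
  have fin: "finite S" using S finite_subset by blast
  define m where "m = Min S"
  have m: "m \<in> S" unfolding m_def using fin S(2) by (rule Min_in)
  then have "m \<noteq> 0" using S by auto
  then have m': "m - 1 \<notin> S" using Min_le[OF fin, of "m - 1"] unfolding m_def by auto
  have "m + k \<in> S \<and> f (m + k - 1) < f (m + k)" for k
  proof (induction k)
    case 0
    then show ?case using m m' gj[of m] S by (auto simp: lower_def)
  next
    case (Suc k)
    then have s: "m + k \<in> S" "f (m + k - 1) < f (m + k)" by auto
    then have le: "f (m + k + 1) \<ge> f (m + k) + int (\<alpha> (m + k + 1))" using blocked[of "m + k"] by linarith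
    have j: "m + k + 1 \<in> {1..n}" using s S by auto
    have "m + k + 1 \<in> S" using gj[OF j] le s by (cases "m + k + 1 \<in> S") (auto simp: lower_def)
    then show ?case using le \<alpha>[OF j] by simp
  qed
  then have "m + n \<in> S" by blast
  then show False using S by auto
qed

text \<open>A chain that does not yet use all indices can be prolonged at one of its ends. If neither end
  allows it, the set \<open>R\<close> of unused indices is closed under neighbours, hence is everything, so that the
  chain is a single vertex; and then either all its entries are full or all of them vanish, against
  \<open>0 < d < \<alpha>\<^sub>1 + \<dots> + \<alpha>\<^sub>n\<close>.\<close>

lemma admissible_extend:
  assumes f: "admissible n d \<alpha> f" and "admissible n d \<alpha> (lower f U)"
    and \<alpha>: "\<And>i. i \<in> {1..n} \<Longrightarrow> 1 \<le> \<alpha> i" and U: "U \<subset> {1..<n}"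
    and d: "0 < d" "d < (\<Sum>i\<in>{1..n}. \<alpha> i)"
  shows "\<exists>r\<in>{1..<n} - U. admissible n d \<alpha> (lower f (insert r U)) \<or> admissible n d \<alpha> (raise f r)"
proof (rule ccontr)
  assume no: "\<not> ?thesis"
  define g where "g = lower f U"
  define R where "R = {1..<n} - U"
  have fj: "f (j - 1) \<le> f j" "f j \<le> f (j - 1) + int (\<alpha> j)" if "j \<in> {1..n}" for j
    using f that by (simp_all add: admissible_def)
  have gj: "g (j - 1) \<le> g j" "g j \<le> g (j - 1) + int (\<alpha> j)" if "j \<in> {1..n}" for j
    using assms(2) that by (simp_all add: admissible_def g_def)
  have stuck: "\<not> admissible n d \<alpha> (lower f (insert r U))" "\<not> admissible n d \<alpha> (raise f r)" if "r \<in> R" for r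
    using no that unfolding R_def by blast+
  have down: "g (r - 1) = g r \<or> g (r + 1) = g r + int (\<alpha> (r + 1))"
    and up: "f r = f (r - 1) + int (\<alpha> r) \<or> f r = f (r + 1)" if "r \<in> R" for r
  proof -
    have r: "r \<in> {1..<n}" "r \<notin> U" using that by (auto simp: R_def)
    have j: "r \<in> {1..n}" "r + 1 \<in> {1..n}" using r by auto
    have "lower g {r} = lower f (insert r U)" using r by (simp add: g_def lower_lower)
    then show "g (r - 1) = g r \<or> g (r + 1) = g r + int (\<alpha> (r + 1))"
      using admissible_lower_single[of n d \<alpha> g r] assms(2) stuck(1)[OF that] r(1) gj[OF j(1)] gj[OF j(2)]
      unfolding g_def by fastforce
    show "f r = f (r - 1) + int (\<alpha> r) \<or> f r = f (r + 1)"
      using admissible_raise[OF f r(1)] stuck(2)[OF that] fj[OF j(1)] fj[OF j(2)] by fastforce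
  qed
  have gf: "g k = f k - of_bool (k \<in> U)" for k by (simp add: g_def lower_def)
  have closed_up: "r + 1 \<notin> U" if "r \<in> R" for r
  proof
    assume "r + 1 \<in> U"
    moreover have j: "r \<in> {1..n}" "r + 1 \<in> {1..n}" "r \<notin> U" using that by (auto simp: R_def)
    ultimately show False
      using down[OF that] up[OF that] gf[of r] gf[of "r + 1"] gf[of "r - 1"] fj[OF j(2)] gj[OF j(2)] \<alpha>[OF j(1)]
      by (cases "r - 1 \<in> U") auto
  qed
  have closed_down: "r - 1 \<notin> U" if "r \<in> R" for r
  proof
    assume "r - 1 \<in> U"
    moreover have j: "r \<in> {1..n}" "r + 1 \<in> {1..n}" "r \<notin> U" using that by (auto simp: R_def)
    ultimately show False
      using down[OF that] up[OF that] gf[of r] gf[of "r + 1"] gf[of "r - 1"] fj[OF j(1)] gj[OF j(1)] \<alpha>[OF j(2)]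
      by (cases "r + 1 \<in> U") auto
  qed
  obtain r0 where r0: "r0 \<in> R" using U unfolding R_def by blast
  have "r0 + k \<in> R" if "r0 + k < n" for k
    using that
  proof (induction k)
    case (Suc k)
    then have "r0 + k \<in> R" by simp
    then show ?case using closed_up[of "r0 + k"] Suc.prems by (auto simp: R_def)
  qed (use r0 in simp)
  then have above: "r \<in> R" if "r0 \<le> r" "r < n" for r using that le_Suc_ex by blast
  have "r0 - k \<in> R" if "k < r0" for k
    using that
  proof (induction k)
    case (Suc k)
    then have "r0 - k \<in> R" by simp
    then show ?case using closed_down[of "r0 - k"] Suc.prems by (auto simp: R_def)
  qed (use r0 in simp)
  then have below: "r \<in> R" if "1 \<le> r" "r \<le> r0" for r
    using that by (metis One_nat_def Suc_le_eq diff_diff_cancel diff_less le_trans)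
  have R: "r \<in> R" if "1 \<le> r" "r < n" for r using above below that by (meson nle_le)
  then have "U = {}" using U unfolding R_def by auto
  then have fg: "g = f" by (simp add: g_def)
  have n: "1 < n" using r0 by (auto simp: R_def)
  have ends: "f 0 = 0" "f n = int d" using f by (simp_all add: admissible_def)
  \<comment> \<open>Now \<open>down\<close> carries a positive entry to the right as a full entry, and \<open>up\<close> carries a zero
    entry to the right as a zero entry.\<close>
  show False
  proof (cases "f 0 < f 1")
    case True
    have pos: "f k < f (Suc k)" if "k < n" for k
      using that
    proof (induction k)
      case (Suc k)
      then have "f (Suc k + 1) = f (Suc k) + int (\<alpha> (Suc k + 1))" using down[OF R, of "Suc k"] fg by auto
      then show ?case using \<alpha>[of "Suc (Suc k)"] Suc.prems by simp
    qed (use True in simp)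
    have full: "f (Suc k) = f k + int (\<alpha> (Suc k))" if "k < n" for k
    proof (cases k)
      case 0
      then show ?thesis using up[OF R, of 1] pos[of 1] n by auto
    next
      case (Suc k')
      then show ?thesis using down[OF R, of k] pos[of k'] that fg by auto
    qed
    have "f k = int (\<Sum>i\<in>{1..k}. \<alpha> i)" if "k \<le> n" for k
      using that by (induction k) (simp_all add: ends full)
    then have "int (\<Sum>i\<in>{1..n}. \<alpha> i) = int d" using ends by (metis order_refl)
    then show False using d(2) by (simp only: of_nat_eq_iff)
  next
    case False
    then have "f 1 = 0" using fj(1)[of 1] n ends by simp
    have "f k = 0" if "1 \<le> k" "k \<le> n" for k
      using that
    proof (induction k rule: dec_induct)
      case (step k)
      then have k: "1 \<le> k" "k < n" "f k = 0" by auto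
      have "f (k - 1) \<ge> 0"
      proof -
        have "0 \<le> f i" if "i \<le> n" for i
          using that by (induction i) (use ends fj(1)[of "Suc _"] in \<open>force+\<close>)
        then show ?thesis using k by simp
      qed
      then show ?case using up[OF R[OF k(1,2)]] \<alpha>[of k] k by auto
    qed (use \<open>f 1 = 0\<close> in simp)
    then show False using ends d n by simp
  qed
qed

text \<open>A flag is a maximal clique together with its signature, in the form in which the exchanges are
  carried out.\<close>

definition flag :: "nat \<Rightarrow> nat \<Rightarrow> (nat \<Rightarrow> nat) \<Rightarrow> vec list \<Rightarrow> nat list \<Rightarrow> bool" where
  "flag n d \<alpha> vs \<sigma> \<longleftrightarrow> length vs = n \<and> set vs \<subseteq> veronese_set n d \<alpha> \<and>
     distinct \<sigma> \<and> set \<sigma> = {1..<n} \<and>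
     (\<forall>i<n. psum (vs ! i) = lower (psum (vs ! 0)) (set (take i \<sigma>)))"

lemma flagD:
  assumes "flag n d \<alpha> vs \<sigma>"
  shows "length vs = n" "length \<sigma> = n - 1" "distinct \<sigma>" "set \<sigma> = {1..<n}"
    "\<And>i. i < n \<Longrightarrow> vs ! i \<in> veronese_set n d \<alpha>"
    "\<And>i. i < n \<Longrightarrow> psum (vs ! i) = lower (psum (vs ! 0)) (set (take i \<sigma>))"
proof -
  show 1: "length vs = n" and 3: "distinct \<sigma>" and 4: "set \<sigma> = {1..<n}"
    using assms unfolding flag_def by blast+
  show "length \<sigma> = n - 1" using distinct_card[OF 3] 4 by simp
  show "vs ! i \<in> veronese_set n d \<alpha>" if "i < n" for i
    using assms that unfolding flag_def by (metis nth_mem subsetD)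
  show "psum (vs ! i) = lower (psum (vs ! 0)) (set (take i \<sigma>))" if "i < n" for i
    using assms that unfolding flag_def by blast
qed

lemma flag_keys: "flag n d \<alpha> vs \<sigma> \<Longrightarrow> i < n \<Longrightarrow> 0 \<notin> Poly_Mapping.keys (vs ! i)"
  by (rule veronese_0, rule flagD(5))

lemma set_take_strict_mono:
  assumes "distinct \<sigma>" "i < j" "j \<le> length \<sigma>"
  shows "set (take i \<sigma>) \<subset> set (take j \<sigma>)"
proof -
  have "card (set (take i \<sigma>)) < card (set (take j \<sigma>))"
    using assms by (simp add: distinct_card)
  moreover have "set (take i \<sigma>) \<subseteq> set (take j \<sigma>)" using assms by (simp add: set_take_subset_set_take)
  ultimately show ?thesis by auto
qed

lemma vertices_eqI:
  assumes "sorted_wrt (\<lambda>a b. b < a) vs"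
  shows "vertices (set vs) = vs"
proof -
  have "sorted_wrt (<) (rev vs)" using assms by (simp add: sorted_wrt_rev)
  then have "sorted_list_of_set (set (rev vs)) = rev vs"
    by (intro sorted_list_of_set.idem_if_sorted_distinct) (simp_all add: strict_sorted_iff)
  then show ?thesis by (simp add: vertices_def)
qed

lemma flag_sorted:
  assumes "flag n d \<alpha> vs \<sigma>"
  shows "sorted_wrt (\<lambda>a b. b < a) vs"
proof (subst sorted_wrt_iff_nth_less, intro allI impI)
  fix i j assume ij: "i < j" "j < length vs"
  note F = flagD[OF assms]
  have "set (take i \<sigma>) \<subset> set (take j \<sigma>)" using ij F(1-3) by (intro set_take_strict_mono) auto
  moreover have p: "psum (vs ! i) = lower (psum (vs ! 0)) (set (take i \<sigma>))"
    "psum (vs ! j) = lower (psum (vs ! 0)) (set (take j \<sigma>))"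
    by (rule F(6); use ij F(1) in simp)+
  ultimately have cov: "covers (vs ! i) (vs ! j)" and "psum (vs ! i) \<noteq> psum (vs ! j)"
    using covers_of_lower[OF p] lower_inject by auto
  then have "vs ! i \<noteq> vs ! j" by metis
  moreover have "0 \<notin> Poly_Mapping.keys (vs ! i)" "0 \<notin> Poly_Mapping.keys (vs ! j)"
    using F(1) ij flag_keys[OF assms] by simp_all
  ultimately show "vs ! j < vs ! i" using covers_less cov by simp
qed

lemma flag_vertices: "flag n d \<alpha> vs \<sigma> \<Longrightarrow> vertices (set vs) = vs"
  by (intro vertices_eqI flag_sorted)

lemma flag_distinct:
  assumes "flag n d \<alpha> vs \<sigma>"
  shows "distinct vs"
proof -
  have "distinct (rev vs)"
    using flag_sorted[OF assms] strict_sorted_iff[of "rev vs"] by (simp add: sorted_wrt_rev)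
  then show ?thesis by simp
qed

lemma flag_clique:
  assumes "flag n d \<alpha> vs \<sigma>"
  shows "clique n d \<alpha> (set vs)"
proof -
  note F = flagD[OF assms]
  have *: "covers (vs ! i) (vs ! j)" if "i \<le> j" "j < n" for i j
    using that by (intro covers_of_lower[OF F(6) F(6)]) (simp_all add: set_take_subset_set_take)
  have "covers a b \<or> covers b a" if ab: "a \<in> set vs" "b \<in> set vs" for a b
  proof -
    obtain i j where "a = vs ! i" "b = vs ! j" "i < n" "j < n"
      using ab F(1) by (auto simp: in_set_conv_nth)
    then show ?thesis using *[of i j] *[of j i] by (meson nle_le)
  qed
  moreover have "set vs \<subseteq> veronese_set n d \<alpha>" using assms unfolding flag_def by blast
  ultimately show ?thesis by (simp add: clique_iff_covers)
qed

lemma flag_step: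
  assumes "flag n d \<alpha> vs \<sigma>" "i < n - 1"
  shows "psum (vs ! (i + 1)) = lower (psum (vs ! i)) {\<sigma> ! i}"
proof -
  note F = flagD[OF assms(1)]
  have "set (take (i + 1) \<sigma>) = set (take i \<sigma>) \<union> {\<sigma> ! i}"
    using assms(2) F(2) by (simp add: take_Suc_conv_app_nth)
  moreover have "\<sigma> ! i \<notin> set (take i \<sigma>)"
    using F(3) assms(2) F(2) distinct_take[OF F(3), of "Suc i"] by (simp add: take_Suc_conv_app_nth)
  ultimately show ?thesis
    using F(6)[of "i + 1"] F(6)[of i] assms(2) lower_lower[of "set (take i \<sigma>)" "{\<sigma> ! i}" "psum (vs ! 0)"]
    by simp
qed

lemma flag_signature:
  assumes "flag n d \<alpha> vs \<sigma>"
  shows "signature n (set vs) = \<sigma>"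
  unfolding signature_def flag_vertices[OF assms]
proof (rule the_equality)
  note F = flagD[OF assms]
  have eq: "vs ! (i + 1) + Poly_Mapping.single s 1 = vs ! i + Poly_Mapping.single (s + 1) 1 \<longleftrightarrow> s = \<sigma> ! i"
    if "i < n - 1" "1 \<le> s" for i s
  proof -
    have "0 \<notin> Poly_Mapping.keys (vs ! i)" "0 \<notin> Poly_Mapping.keys (vs ! (i + 1))"
      using that(1) flag_keys[OF assms] by simp_all
    then show ?thesis using flag_step[OF assms that(1)] that(2)
      by (subst psum_step_iff) (auto simp: lower_inject)
  qed
  show "length \<sigma> = n - 1 \<and> distinct \<sigma> \<and> set \<sigma> = {1..n - 1} \<and>
    (\<forall>i<n - 1. vs ! (i + 1) + Poly_Mapping.single (\<sigma> ! i) 1 = vs ! i + Poly_Mapping.single (\<sigma> ! i + 1) 1)"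
  proof (intro conjI allI impI)
    have "{1..<n} = {1..n - 1}" by (cases n) (simp_all add: atLeastLessThanSuc_atLeastAtMost)
    then show "set \<sigma> = {1..n - 1}" by (simp only: F(4))
    fix i assume i: "i < n - 1"
    then have "\<sigma> ! i \<in> set \<sigma>" using F(2) by simp
    then have "1 \<le> \<sigma> ! i" using F(4) by simp
    from eq[OF i this] show "vs ! (i + 1) + Poly_Mapping.single (\<sigma> ! i) 1 = vs ! i + Poly_Mapping.single (\<sigma> ! i + 1) 1"
      by blast
  qed (use F(2,3) in auto)
  fix s assume s: "length s = n - 1 \<and> distinct s \<and> set s = {1..n - 1} \<and>
    (\<forall>i<n - 1. vs ! (i + 1) + Poly_Mapping.single (s ! i) 1 = vs ! i + Poly_Mapping.single (s ! i + 1) 1)"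
  show "s = \<sigma>"
  proof (rule nth_equalityI)
    fix i assume i: "i < length s"
    then have "s ! i \<in> set s" by simp
    then have "1 \<le> s ! i" using s by simp
    then show "s ! i = \<sigma> ! i" using eq[of i "s ! i"] s i by metis
  qed (use s F(2) in simp)
qed

locale veronese_type =
  fixes n d :: nat and \<alpha> :: "nat \<Rightarrow> nat"
  assumes n_pos: "1 \<le> n" and d_pos: "0 < d" and alpha_pos: "\<And>i. i \<in> {1..n} \<Longrightarrow> 1 \<le> \<alpha> i"
    and d_less: "d < (\<Sum>i\<in>{1..n}. \<alpha> i)"
begin

lemma veronese_nonempty: "veronese_set n d \<alpha> \<noteq> {}"
proof -
  \<comment> \<open>The partial sums of the vector obtained by filling up the entries from the left.\<close>
  define f where "f k = min (int d) (int (\<Sum>i\<in>{1..min k n}. \<alpha> i))" for k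
  have "admissible n d \<alpha> f"
    unfolding admissible_def
  proof (intro conjI allI impI ballI)
    fix j assume "j \<in> {1..n}"
    then obtain i where "j = Suc i" "Suc i \<le> n" by (cases j) auto
    then show "f (j - 1) \<le> f j" "f j \<le> f (j - 1) + int (\<alpha> j)" by (auto simp: f_def)
  qed (use d_less in \<open>auto simp: f_def simp flip: of_nat_sum\<close>)
  then obtain a where "a \<in> veronese_set n d \<alpha>" by (rule admissible_psum_ex)
  then show ?thesis by blast
qed

lemma MC_nonempty:
  assumes "A \<in> MC n d \<alpha>"
  shows "A \<noteq> {}"
proof
  assume "A = {}"
  obtain a where "a \<in> veronese_set n d \<alpha>" using veronese_nonempty by blast
  then have "clique n d \<alpha> {a}" by (simp add: clique_iff_covers)
  then show False using assms \<open>A = {}\<close> by (auto simp: MC_def)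
qed

text \<open>By interpolation, consecutive vertices of a maximal clique differ in one partial sum only, and
  by extension every partial sum is lowered at some point.\<close>

lemma MC_is_flag:
  assumes A: "A \<in> MC n d \<alpha>"
  obtains vs \<sigma> where "flag n d \<alpha> vs \<sigma>" "A = set vs"
proof -
  let ?V = "veronese_set n d \<alpha>"
  have AV: "A \<subseteq> ?V" and cl: "\<And>a b. a \<in> A \<Longrightarrow> b \<in> A \<Longrightarrow> covers a b \<or> covers b a"
    using A by (auto simp: MC_def clique_iff_covers)
  have fin: "finite A" using AV finite_veronese_set finite_subset by blast
  have maximal: "h \<in> A" if h: "h \<in> ?V" "\<And>a. a \<in> A \<Longrightarrow> covers a h \<or> covers h a" for h
  proof -
    have "clique n d \<alpha> (insert h A)" using h AV cl by (auto simp: clique_iff_covers)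
    then show ?thesis using A by (auto simp: MC_def)
  qed
  define vs where "vs = vertices A"
  define m where "m = length vs"
  have vs: "set vs = A" "sorted_wrt (\<lambda>a b. b < a) vs"
    using fin by (simp_all add: vs_def vertices_def sorted_wrt_rev)
  have "0 < m" using MC_nonempty[OF A] vs(1) by (auto simp: m_def)
  have nth: "vs ! i \<in> A" if "i < m" for i using that vs(1) by (auto simp: m_def)
  have less: "vs ! j < vs ! i" if "i < j" "j < m" for i j
    using vs(2) that by (simp add: sorted_wrt_iff_nth_less m_def)
  have cov: "covers (vs ! i) (vs ! j)" if "i \<le> j" "j < m" for i j
  proof (cases "i = j")
    case False
    then have "vs ! j < vs ! i" using less that by simp
    moreover have "vs ! i \<in> A" "vs ! j \<in> A" using nth that by auto
    ultimately show ?thesis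
      using cl[of "vs ! i" "vs ! j"] covers_less[of "vs ! j" "vs ! i"] AV veronese_0
      by (metis less_asym less_irrefl subsetD)
  qed simp
  define f where "f = psum (vs ! 0)"
  define U where "U i = {k. psum (vs ! i) k \<noteq> f k}" for i
  have lowU: "psum (vs ! i) = lower f (U i)" if "i < m" for i
  proof
    fix k
    show "psum (vs ! i) k = lower f (U i) k"
      using cov[of 0 i] that unfolding covers_def f_def[symmetric]
      by (auto simp: lower_def U_def dest!: spec[of _ k])
  qed
  have adm: "admissible n d \<alpha> (psum (vs ! i))" if "i < m" for i
    using nth[OF that] AV admissible_psum by blast
  have U0: "U 0 = {}" by (simp add: U_def f_def)
  have Usub: "U i \<subseteq> {1..<n}" if "i < m" for i
  proof
    fix k assume "k \<in> U i"
    then have "psum (vs ! i) k \<noteq> psum (vs ! 0) k" by (simp add: U_def f_def)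
    then show "k \<in> {1..<n}"
      using adm[OF that] adm[OF \<open>0 < m\<close>] unfolding admissible_def
      by (metis atLeastLessThan_iff leI less_one)
  qed
  have Ule: "U i \<subseteq> U j" if "i \<le> j" "j < m" for i j
  proof
    fix k assume "k \<in> U i"
    moreover have "psum (vs ! j) k \<le> psum (vs ! i) k" using cov[OF that] by (simp add: covers_def)
    ultimately show "k \<in> U j" using lowU[of i] lowU[of j] that by (auto simp: lower_def)
  qed
  have Une: "U i \<noteq> U j" if "i < j" "j < m" for i j
  proof
    assume "U i = U j"
    then have "psum (vs ! i) = psum (vs ! j)" using lowU that by simp
    then have "vs ! i = vs ! j"
      using psum_inject[OF veronese_0 veronese_0] AV nth[of i] nth[of j] that by (metis less_trans subsetD)
    then show False using less[OF that] by simp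
  qed
  have exj: "\<exists>j<m. h = vs ! j" if "h \<in> A" for h
    using that vs(1) by (metis in_set_conv_nth m_def)
  have step: "\<exists>s. s \<notin> U i \<and> U (Suc i) = insert s (U i)" if i: "Suc i < m" for i
  proof -
    let ?S = "U (Suc i) - U i"
    have "psum (vs ! Suc i) = lower (psum (vs ! i)) ?S"
      using lowU[of i] lowU[OF i] Ule[of i "Suc i"] i by (simp add: lower_lower Un_absorb1)
    moreover have "?S \<noteq> {}" using Ule[of i "Suc i"] Une[of i "Suc i"] i by auto
    moreover have "?S \<subseteq> {1..<n}" using Usub[OF i] by blast
    ultimately obtain s where s: "s \<in> ?S" "admissible n d \<alpha> (lower (psum (vs ! i)) {s})"
      using admissible_interpolate[of n d \<alpha> "psum (vs ! i)" ?S] adm[of i] adm[OF i] alpha_pos i by auto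
    then obtain h where h: "h \<in> ?V" "psum h = lower (psum (vs ! i)) {s}"
      using admissible_psum_ex by blast
    then have ph: "psum h = lower f (insert s (U i))" using lowU[of i] s(1) i by (simp add: lower_lower)
    have "covers a h \<or> covers h a" if "a \<in> A" for a
    proof -
      obtain j where j: "j < m" "a = vs ! j" using exj \<open>a \<in> A\<close> by blast
      show ?thesis
      proof (cases "j \<le> i")
        case True
        then have "U j \<subseteq> insert s (U i)" using Ule[of j i] i by auto
        then show ?thesis using covers_of_lower[OF lowU[OF j(1)] ph] j by simp
      next
        case False
        then have "U (Suc i) \<subseteq> U j" using Ule[of "Suc i" j] j by auto
        then have "insert s (U i) \<subseteq> U j" using s(1) Ule[of i "Suc i"] i by auto
        then show ?thesis using covers_of_lower[OF ph lowU[OF j(1)]] j by simp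
      qed
    qed
    then obtain j where j: "j < m" "h = vs ! j" using maximal[OF h(1)] exj by blast
    then have Uj: "U j = insert s (U i)" using ph lowU[OF j(1)] by (simp add: lower_inject)
    then have "\<not> j \<le> i" using Ule[of j i] s(1) i by auto
    then have "U (Suc i) \<subseteq> insert s (U i)" using Ule[of "Suc i" j] j Uj by simp
    then have "U (Suc i) = insert s (U i)" using s(1) Ule[of i "Suc i"] i by auto
    then show ?thesis using s(1) by blast
  qed
  have top: "U (m - 1) = {1..<n}"
  proof (rule ccontr)
    assume "U (m - 1) \<noteq> {1..<n}"
    then have "U (m - 1) \<subset> {1..<n}" using Usub[of "m - 1"] \<open>0 < m\<close> by auto
    then have "\<exists>r\<in>{1..<n} - U (m - 1). admissible n d \<alpha> (lower f (insert r (U (m - 1)))) \<or> admissible n d \<alpha> (raise f r)"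
      using adm[of 0] adm[of "m - 1"] lowU[of "m - 1"] \<open>0 < m\<close> alpha_pos d_pos d_less
      by (intro admissible_extend) (simp_all add: f_def)
    then obtain r where r: "r \<in> {1..<n} - U (m - 1)"
      "admissible n d \<alpha> (lower f (insert r (U (m - 1)))) \<or> admissible n d \<alpha> (raise f r)"
      by blast
    have Uj: "U j \<subseteq> U (m - 1)" if "j < m" for j using Ule[of j "m - 1"] that by simp
    from r(2) show False
    proof
      assume "admissible n d \<alpha> (lower f (insert r (U (m - 1))))"
      then obtain h where h: "h \<in> ?V" "psum h = lower f (insert r (U (m - 1)))"
        using admissible_psum_ex by blast
      have "covers a h" if "a \<in> A" for a
      proof -
        obtain j where "j < m" "a = vs ! j" using exj \<open>a \<in> A\<close> by blast
        then show ?thesis using covers_of_lower[OF lowU h(2)] Uj[of j] by auto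
      qed
      then obtain j where j: "j < m" "h = vs ! j" using maximal[OF h(1)] exj by blast
      then have "U j = insert r (U (m - 1))" using h(2) lowU[OF j(1)] by (simp add: lower_inject)
      then show False using Uj[OF j(1)] r(1) by blast
    next
      assume "admissible n d \<alpha> (raise f r)"
      then obtain h where h: "h \<in> ?V" "psum h = raise f r"
        using admissible_psum_ex by blast
      have fh: "f = lower (psum h) {r}" by (auto simp: h(2) lower_def raise_def)
      have "covers h a" if "a \<in> A" for a
      proof -
        obtain j where j: "j < m" "a = vs ! j" using exj \<open>a \<in> A\<close> by blast
        then have "r \<notin> U j" using Uj[of j] r(1) by blast
        then have "psum a = lower (psum h) ({r} \<union> U j)"
          using lowU[OF j(1)] fh j(2) lower_lower[of "{r}" "U j" "psum h"] by simp
        then show ?thesis using covers_iff_lower by blast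
      qed
      then obtain j where j: "j < m" "h = vs ! j" using maximal[OF h(1)] exj by blast
      then have "psum h r \<le> f r" using lowU[OF j(1)] by (simp add: lower_def)
      then show False by (simp add: h(2) raise_def)
    qed
  qed
  obtain s where s: "\<And>i. Suc i < m \<Longrightarrow> s i \<notin> U i \<and> U (Suc i) = insert (s i) (U i)"
    using step by metis
  define \<sigma> where "\<sigma> = map s [0..<m - 1]"
  have take: "set (take i \<sigma>) = U i" and card: "card (U i) = i" if "i < m" for i
  proof -
    have "set (take i \<sigma>) = U i \<and> card (U i) = i"
      using that
    proof (induction i)
      case (Suc i)
      then have "i < length \<sigma>" by (simp add: \<sigma>_def)
      moreover have "finite (U i)" using Usub[of i] Suc.prems finite_subset[of "U i" "{1..<n}"] by simp
      ultimately show ?case using Suc s[of i] by (simp add: take_Suc_conv_app_nth \<sigma>_def)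
    qed (simp add: U0)
    then show "set (take i \<sigma>) = U i" "card (U i) = i" by auto
  qed
  have "m = n" using card[of "m - 1"] top \<open>0 < m\<close> n_pos by simp
  have set\<sigma>: "set \<sigma> = {1..<n}" using take[of "m - 1"] top \<open>0 < m\<close> by (simp add: \<sigma>_def)
  then have "distinct \<sigma>" using \<open>m = n\<close> by (intro card_distinct) (simp add: \<sigma>_def)
  moreover have "psum (vs ! i) = lower (psum (vs ! 0)) (set (take i \<sigma>))" if "i < n" for i
    using lowU[of i] take[of i] that unfolding \<open>m = n\<close> f_def by metis
  moreover have "length vs = n" using \<open>m = n\<close> by (simp add: m_def)
  ultimately have "flag n d \<alpha> vs \<sigma>"
    using set\<sigma> vs(1) AV unfolding flag_def by blast
  then show thesis using that vs(1) by blast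
qed

text \<open>All maximal cliques have \<open>n\<close> elements, so a clique with \<open>n\<close> elements is maximal.\<close>

lemma flag_MC:
  assumes "flag n d \<alpha> vs \<sigma>"
  shows "set vs \<in> MC n d \<alpha>"
proof -
  obtain B where B: "B \<in> MC n d \<alpha>" "set vs \<subseteq> B" using clique_subset_MC[OF flag_clique[OF assms]] by blast
  obtain ws \<pi> where ws: "flag n d \<alpha> ws \<pi>" "B = set ws" using MC_is_flag[OF B(1)] by blast
  have "card (set vs) = card B"
    using flag_distinct[OF assms] flag_distinct[OF ws(1)] flagD(1)[OF assms] flagD(1)[OF ws(1)] ws(2)
    by (simp add: distinct_card)
  then have "set vs = B" using B(2) ws(2) by (simp add: card_subset_eq)
  then show ?thesis using B(1) by simp
qed

end

section \<open>Relative signatures\<close>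

definition position :: "nat list \<Rightarrow> nat \<Rightarrow> nat" where
  "position \<tau> x = (THE i. i < length \<tau> \<and> \<tau> ! i = x)"

lemma position_nth:
  assumes "distinct \<tau>" "i < length \<tau>"
  shows "position \<tau> (\<tau> ! i) = i"
  unfolding position_def using assms by (intro the_equality) (auto simp: nth_eq_iff_index_eq)

lemma position_less:
  assumes "distinct \<tau>" "x \<in> set \<tau>"
  shows "position \<tau> x < length \<tau>" "\<tau> ! position \<tau> x = x"
  using assms position_nth by (metis in_set_conv_nth)+

lemma position_inject:
  assumes "distinct \<tau>" "x \<in> set \<tau>" "y \<in> set \<tau>"
  shows "position \<tau> x = position \<tau> y \<longleftrightarrow> x = y"
  using assms position_less(2) by metis

lemma position_append:
  assumes "distinct (t @ r)"
  shows "y \<in> set t \<Longrightarrow> position (t @ r) y < length t"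
    and "x \<in> set r \<Longrightarrow> length t \<le> position (t @ r) x"
proof -
  show "position (t @ r) y < length t" if y: "y \<in> set t"
  proof -
    obtain i where "i < length t" "y = t ! i" using y by (auto simp: in_set_conv_nth)
    then show ?thesis using position_nth[OF assms, of i] by (simp add: nth_append)
  qed
  show "length t \<le> position (t @ r) x" if x: "x \<in> set r"
  proof -
    obtain i where "i < length r" "x = r ! i" using x by (auto simp: in_set_conv_nth)
    then show ?thesis using position_nth[OF assms, of "length t + i"] by (simp add: nth_append)
  qed
qed

lemma relative_signature_eq:
  assumes "distinct \<tau>" "set k \<subseteq> set \<tau>"
  shows "relative_signature \<tau> k = map (\<lambda>x. Suc (position \<tau> x)) k"
  unfolding relative_signature_def
proof (rule the_equality)
  have "position \<tau> x < length \<tau> \<and> \<tau> ! position \<tau> x = x" if "x \<in> set k" for x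
    using position_less[OF assms(1)] assms(2) that by blast
  then show "length (map (\<lambda>x. Suc (position \<tau> x)) k) = length k \<and>
      set (map (\<lambda>x. Suc (position \<tau> x)) k) \<subseteq> {1..length \<tau>} \<and>
      (\<forall>i<length k. \<tau> ! (map (\<lambda>x. Suc (position \<tau> x)) k ! i - 1) = k ! i)"
    by (auto simp: Suc_le_eq)
  fix s assume s: "length s = length k \<and> set s \<subseteq> {1..length \<tau>} \<and> (\<forall>i<length k. \<tau> ! (s ! i - 1) = k ! i)"
  show "s = map (\<lambda>x. Suc (position \<tau> x)) k"
  proof (rule nth_equalityI)
    fix i assume i: "i < length s"
    then have "s ! i \<in> {1..length \<tau>}" using s nth_mem by blast
    then have "position \<tau> (\<tau> ! (s ! i - 1)) = s ! i - 1" "1 \<le> s ! i"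
      by (auto intro!: position_nth[OF assms(1)])
    then show "s ! i = map (\<lambda>x. Suc (position \<tau> x)) k ! i" using s i by simp
  qed (use s in simp)
qed

text \<open>The order within a class is the lexicographic order of signatures over the alphabet \<open>{1..n-1}\<close>
  ordered as in \<open>\<tau>\<close>.\<close>

lemma first_diff_neg_relative_iff:
  assumes "distinct \<tau>" "set k \<subseteq> set \<tau>" "set l \<subseteq> set \<tau>" "length k = length l"
  shows "first_diff_neg (relative_signature \<tau> k) (relative_signature \<tau> l) \<longleftrightarrow>
    (\<exists>i<length k. position \<tau> (k ! i) < position \<tau> (l ! i) \<and> (\<forall>j<i. k ! j = l ! j))"
proof -
  have "position \<tau> (k ! j) = position \<tau> (l ! j) \<longleftrightarrow> k ! j = l ! j" if "j < length k" for j
    using that assms(4) nth_mem[of j k] nth_mem[of j l] assms(2,3) by (intro position_inject[OF assms(1)]) auto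
  then have "(i < length k \<and> map (\<lambda>x. Suc (position \<tau> x)) k ! i < map (\<lambda>x. Suc (position \<tau> x)) l ! i \<and>
        (\<forall>j<i. map (\<lambda>x. Suc (position \<tau> x)) k ! j = map (\<lambda>x. Suc (position \<tau> x)) l ! j)) \<longleftrightarrow>
      (i < length k \<and> position \<tau> (k ! i) < position \<tau> (l ! i) \<and> (\<forall>j<i. k ! j = l ! j))" for i
    using assms(4) by (cases "i < length k") simp_all
  then show ?thesis
    by (simp only: first_diff_neg_def relative_signature_eq[OF assms(1,2)] relative_signature_eq[OF assms(1,3)] length_map)
qed

section \<open>Exchanging one vertex of a maximal clique\<close>

text \<open>Admissibility only compares neighbouring partial sums, so it can be verified for each pair of
  neighbours on a different lowered set that is already known to be admissible.\<close>

lemma admissible_lower_local: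
  assumes "U \<subseteq> {1..<n}" "admissible n d \<alpha> f"
    and "\<And>j. j \<in> {1..n} \<Longrightarrow>
      \<exists>W. admissible n d \<alpha> (lower f W) \<and> (j \<in> U \<longleftrightarrow> j \<in> W) \<and> (j - 1 \<in> U \<longleftrightarrow> j - 1 \<in> W)"
  shows "admissible n d \<alpha> (lower f U)"
proof -
  have "lower f U (j - 1) \<le> lower f U j \<and> lower f U j \<le> lower f U (j - 1) + int (\<alpha> j)" if j: "j \<in> {1..n}" for j
  proof -
    obtain W where "admissible n d \<alpha> (lower f W)" "j \<in> U \<longleftrightarrow> j \<in> W" "j - 1 \<in> U \<longleftrightarrow> j - 1 \<in> W"
      using assms(3)[OF j] by blast
    moreover from this have "lower f U j = lower f W j" "lower f U (j - 1) = lower f W (j - 1)"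
      by (simp_all add: lower_def)
    ultimately show ?thesis using j by (simp add: admissible_def)
  qed
  then show ?thesis using assms(1,2) by (auto simp: admissible_def lower_def)
qed

text \<open>A descent of \<open>\<sigma>\<close> relative to \<open>\<tau>\<close> can be undone. The only new constraint couples the two exchanged
  steps, and the flag of \<open>\<tau>\<close>, which takes them in the new order, shows that it holds.\<close>

lemma flag_swap:
  assumes vs: "flag n d \<alpha> vs \<sigma>" and ls: "flag n d \<alpha> ls \<tau>" "ls ! 0 = vs ! 0"
    and i: "Suc i < n - 1" and desc: "position \<tau> (\<sigma> ! Suc i) < position \<tau> (\<sigma> ! i)"
  obtains us where "flag n d \<alpha> us (\<sigma>[i := \<sigma> ! Suc i, Suc i := \<sigma> ! i])" "us ! 0 = vs ! 0"
    "set vs - set us \<subseteq> {vs ! Suc i}"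
proof -
  note F = flagD[OF vs] and G = flagD[OF ls(1)]
  define f where "f = psum (vs ! 0)"
  define s where "s = \<sigma> ! i"
  define t where "t = \<sigma> ! Suc i"
  define W where "W = set (take i \<sigma>)"
  define \<pi> where "\<pi> = \<sigma>[i := t, Suc i := s]"
  have psum_f: "psum (vs ! k) = lower f (set (take k \<sigma>))" if "k < n" for k
    unfolding f_def by (rule F(6)[OF that])
  have len: "i < length \<sigma>" "Suc i < length \<sigma>" using i F(2) by auto
  have st: "s \<in> set \<sigma>" "t \<in> set \<sigma>" "s \<noteq> t" using len F(3) by (auto simp: s_def t_def nth_eq_iff_index_eq)
  have take1: "set (take (Suc i) \<sigma>) = insert s W" and take2: "set (take (Suc (Suc i)) \<sigma>) = insert t (insert s W)"
    using len by (simp_all add: take_Suc_conv_app_nth W_def s_def t_def insert_commute)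
  have adm: "admissible n d \<alpha> (lower f (set (take k \<sigma>)))" if "k < n" for k
    using admissible_psum[OF F(5)[OF that]] psum_f[OF that] by simp
  have "W \<subseteq> set \<sigma>" by (auto simp: W_def dest: in_set_takeD)
  define p where "p = position \<tau> t"
  have p: "p < length \<tau>" "\<tau> ! p = t" using position_less[OF G(3), of t] st(2) F(4) G(4) by (auto simp: p_def)
  \<comment> \<open>A stage of the flag of \<open>\<tau>\<close> at which \<open>t\<close> has been taken but not yet \<open>s\<close>.\<close>
  define Z where "Z = set (take (Suc p) \<tau>)"
  have "Suc p < n"
    using desc position_less(1)[OF G(3), of s] st(1) F(4) G(2,4) unfolding p_def s_def t_def by simp
  then have admZ: "admissible n d \<alpha> (lower f Z)"
    using admissible_psum[OF G(5)] G(6)[of "Suc p"] ls(2) unfolding Z_def f_def by metis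
  have "t \<in> Z" using p by (simp add: Z_def take_Suc_conv_app_nth)
  have "s \<notin> Z"
  proof
    assume "s \<in> Z"
    then obtain j where "j < Suc p" "\<tau> ! j = s" "j < length \<tau>"
      unfolding Z_def by (auto simp: in_set_conv_nth)
    then show False using position_nth[OF G(3), of j] desc by (simp add: p_def s_def t_def)
  qed
  have "admissible n d \<alpha> (lower f (insert t W))"
  proof (rule admissible_lower_local)
    show "insert t W \<subseteq> {1..<n}" using st(2) \<open>W \<subseteq> set \<sigma>\<close> F(4) by auto
    show "admissible n d \<alpha> f" using adm[of 0] i by simp
    fix j
    have adms: "admissible n d \<alpha> (lower f W)" "admissible n d \<alpha> (lower f (insert t (insert s W)))"
      using adm[of i] adm[of "Suc (Suc i)"] i take2 by (simp_all add: W_def)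
    have "s \<notin> W" using F(3) len distinct_take[OF F(3), of "Suc i"]
      by (simp add: take_Suc_conv_app_nth W_def s_def)
    consider "j \<noteq> s" "j - 1 \<noteq> s" | "j \<noteq> t" "j - 1 \<noteq> t" | "j = s" "j - 1 = t" | "j = t" "j - 1 = s"
      using st(3) by blast
    then show "\<exists>W'. admissible n d \<alpha> (lower f W') \<and> (j \<in> insert t W \<longleftrightarrow> j \<in> W') \<and> (j - 1 \<in> insert t W \<longleftrightarrow> j - 1 \<in> W')"
    proof cases
      case 1
      then show ?thesis using adms(2) by (intro exI[of _ "insert t (insert s W)"]) simp
    next
      case 2
      then show ?thesis using adms(1) by (intro exI[of _ W]) simp
    next
      case 3
      then show ?thesis using admZ \<open>t \<in> Z\<close> \<open>s \<notin> Z\<close> \<open>s \<notin> W\<close> st(3) by (intro exI[of _ Z]) simp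
    next
      case 4
      then show ?thesis using admZ \<open>t \<in> Z\<close> \<open>s \<notin> Z\<close> \<open>s \<notin> W\<close> st(3) by (intro exI[of _ Z]) simp
    qed
  qed
  then obtain h where h: "h \<in> veronese_set n d \<alpha>" "psum h = lower f (insert t W)"
    using admissible_psum_ex by blast
  define us where "us = vs[Suc i := h]"
  have us0: "us ! 0 = vs ! 0" by (simp add: us_def)
  have take\<pi>: "set (take k \<pi>) = (if k = Suc i then insert t W else set (take k \<sigma>))" for k
  proof -
    consider "k \<le> i" | "k = Suc i" | "Suc i < k" by linarith
    then show ?thesis
    proof cases
      case 1
      then show ?thesis by (simp add: \<pi>_def)
    next
      case 2
      then show ?thesis using len by (simp add: \<pi>_def take_Suc_conv_app_nth W_def)
    next
      case 3
      have "take k \<pi> = (take k \<sigma>)[i := take k \<sigma> ! Suc i, Suc i := take k \<sigma> ! i]"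
        using 3 by (simp add: \<pi>_def s_def t_def take_update_swap)
      moreover have "i < length (take k \<sigma>)" "Suc i < length (take k \<sigma>)" using 3 len by auto
      ultimately have "set (take k \<pi>) = set (take k \<sigma>)" using set_swap by metis
      then show ?thesis using 3 by simp
    qed
  qed
  have "psum (us ! k) = lower (psum (us ! 0)) (set (take k \<pi>))" if "k < n" for k
    unfolding take\<pi> us0 f_def[symmetric] using psum_f[OF that] h(2) i F(1)
    by (cases "k = Suc i") (simp_all add: us_def)
  moreover have "length us = n" "set us \<subseteq> veronese_set n d \<alpha>"
    using F(1) h(1) vs set_update_subset_insert[of vs "Suc i" h] unfolding flag_def us_def by auto
  moreover have "distinct \<pi>" "set \<pi> = {1..<n}"
    using len F(3,4) by (simp_all add: \<pi>_def s_def t_def)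
  ultimately have "flag n d \<alpha> us \<pi>" unfolding flag_def by blast
  moreover have "set vs - set us \<subseteq> {vs ! Suc i}"
  proof
    fix v assume v: "v \<in> set vs - set us"
    then obtain k where k: "k < n" "v = vs ! k" using F(1) by (auto simp: in_set_conv_nth)
    have "k = Suc i"
    proof (rule ccontr)
      assume "k \<noteq> Suc i"
      then have "v = us ! k" "k < length us" using k F(1) by (auto simp: us_def)
      then show False using v by auto
    qed
    then show "v \<in> {vs ! Suc i}" using k by simp
  qed
  ultimately show thesis using that us0 unfolding \<pi>_def s_def t_def by blast
qed

text \<open>The first vertex can be replaced by a new last one, which repeats the first step \<open>\<sigma>\<^sub>1\<close>. That step
  is impossible only at the two ends, where entry \<open>1\<close> would become negative or entry \<open>n\<close> too large.\<close>

lemma flag_rotate: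
  assumes vs: "flag n d \<alpha> vs \<sigma>" and n: "2 \<le> n"
    and first: "\<sigma> ! 0 = 1 \<Longrightarrow> 2 \<le> psum (vs ! 0) 1"
    and last: "\<sigma> ! 0 = n - 1 \<Longrightarrow> int d + 2 \<le> psum (vs ! 0) (n - 1) + int (\<alpha> n)"
  obtains us \<pi> where "flag n d \<alpha> us \<pi>" "us ! 0 = vs ! 1" "set vs - set us \<subseteq> {vs ! 0}"
proof -
  note F = flagD[OF vs]
  define f where "f = psum (vs ! 0)"
  obtain s \<sigma>' where \<sigma>: "\<sigma> = s # \<sigma>'" using F(2) n by (cases \<sigma>) auto
  obtain v vs' where vs_eq: "vs = v # vs'" using F(1) n by (cases vs) auto
  have len: "length \<sigma>' = n - 2" "length vs' = n - 1" using F(1,2) \<sigma> vs_eq by auto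
  have s: "s \<in> {1..<n}" using F(4) \<sigma> by auto
  have nth_vs': "vs' ! k = vs ! Suc k" for k by (simp add: vs_eq)
  have psum_f: "psum (vs ! k) = lower f (set (take k \<sigma>))" if "k < n" for k
    unfolding f_def by (rule F(6)[OF that])
  have adm: "admissible n d \<alpha> (lower f (set (take k \<sigma>)))" if "k < n" for k
    using admissible_psum[OF F(5)[OF that]] psum_f[OF that] by simp
  define g where "g = lower (lower f {s}) {1..<n}"
  have "take (n - 1) \<sigma> = \<sigma>" using F(2) by simp
  then have admU: "admissible n d \<alpha> (lower f {1..<n})" using adm[of "n - 1"] F(4) n by simp
  have adms: "admissible n d \<alpha> (lower f {s})" using adm[of 1] n \<sigma> by simp
  have admf: "admissible n d \<alpha> f" using adm[of 0] n by simp
  have "admissible n d \<alpha> g"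
    unfolding admissible_def
  proof (intro conjI ballI allI impI)
    show "g 0 = 0" using admf s by (simp add: g_def lower_def admissible_def)
    show "g k = int d" if "n \<le> k" for k using that admf s by (simp add: g_def lower_def admissible_def)
    fix j assume j: "j \<in> {1..n}"
    have nb: "h (j - 1) \<le> h j \<and> h j \<le> h (j - 1) + int (\<alpha> j)" if "admissible n d \<alpha> h" for h
      using that j by (simp add: admissible_def)
    consider "j = 1" | "j = n" | "j \<in> {1..<n}" "j - 1 \<in> {1..<n}" using j by force
    then have "g (j - 1) \<le> g j \<and> g j \<le> g (j - 1) + int (\<alpha> j)"
    proof cases
      case 1
      have "f 0 = 0" using admf by (simp add: admissible_def)
      with 1 show ?thesis using nb[OF admf] nb[OF admU] first n s
        by (cases "s = 1") (auto simp: g_def lower_def f_def[symmetric] \<sigma>)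
    next
      case 2
      have "f n = int d" using admf by (simp add: admissible_def)
      with 2 show ?thesis using nb[OF admf] nb[OF admU] last n s
        by (cases "s = n - 1") (auto simp: g_def lower_def f_def[symmetric] \<sigma>)
    next
      case 3
      then have "g j = lower f {s} j - 1" "g (j - 1) = lower f {s} (j - 1) - 1"
        by (simp_all add: g_def lower_def)
      then show ?thesis using nb[OF adms] by simp
    qed
    then show "g (j - 1) \<le> g j" "g j \<le> g (j - 1) + int (\<alpha> j)" by blast+
  qed
  then obtain h where h: "h \<in> veronese_set n d \<alpha>" "psum h = g" using admissible_psum_ex by blast
  define us where "us = vs' @ [h]"
  define \<pi> where "\<pi> = \<sigma>' @ [s]"
  have set\<pi>: "set \<pi> = {1..<n}" "distinct \<pi>" using F(3,4) \<sigma> by (auto simp: \<pi>_def)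
  have us0: "us ! 0 = vs ! 1" using len n by (simp add: us_def nth_append nth_vs')
  have psum_us0: "psum (us ! 0) = lower f {s}" using psum_f[of 1] n us0 \<sigma> by simp
  have "psum (us ! k) = lower (psum (us ! 0)) (set (take k \<pi>))" if k: "k < n" for k
  proof (cases "k = n - 1")
    case True
    then have "us ! k = h" "take k \<pi> = \<pi>" using len n by (auto simp: us_def \<pi>_def nth_append)
    then show ?thesis using h(2) psum_us0 set\<pi> by (simp add: g_def)
  next
    case False
    then have k': "Suc k < n" using k by simp
    then have "us ! k = vs ! Suc k" "take k \<pi> = take k \<sigma>'" using len by (auto simp: us_def \<pi>_def nth_append nth_vs')
    moreover have "s \<notin> set (take k \<sigma>')" using F(3) \<sigma> by (auto dest: in_set_takeD)
    ultimately show ?thesis using psum_f[OF k'] psum_us0 \<sigma> by (simp add: lower_lower)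
  qed
  moreover have "length us = n" "set us \<subseteq> veronese_set n d \<alpha>"
    using len n h(1) vs unfolding flag_def us_def vs_eq by auto
  ultimately have "flag n d \<alpha> us \<pi>" using set\<pi> unfolding flag_def by blast
  moreover have "set vs - set us \<subseteq> {vs ! 0}" by (auto simp: us_def vs_eq)
  ultimately show thesis using that us0 by blast
qed

section \<open>The order on the maximal cliques\<close>

lemma sum_psum_eq:
  "(\<Sum>j\<in>{1..m}. int (Poly_Mapping.lookup a j) * int (Suc m - j)) = (\<Sum>k\<in>{1..m}. psum a k)"
proof (induction m)
  case (Suc m)
  have "(\<Sum>j\<in>{1..m}. int (Poly_Mapping.lookup a j) * int (Suc (Suc m) - j)) =
      (\<Sum>j\<in>{1..m}. int (Poly_Mapping.lookup a j) * int (Suc m - j) + int (Poly_Mapping.lookup a j))"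
    by (rule sum.cong) (simp_all add: Suc_diff_le algebra_simps)
  then show ?case using Suc by (simp add: sum.distrib psum_Suc) (simp add: psum_def)
qed simp

text \<open>By Abel summation the weights \<open>n - j\<close> in the rank turn entries into partial sums; and the last
  vertex differs from the first by one in each of the \<open>n - 1\<close> partial sums.\<close>

lemma clique_rank_flag:
  assumes "flag n d \<alpha> vs \<sigma>" "1 \<le> n"
  shows "clique_rank n d \<alpha> (set vs) = (\<Sum>k\<in>{1..n - 1}. psum (vs ! 0) k) - int (n - 1) -
    (\<Sum>k\<in>{1..n - 1}. psum (Min (veronese_set n d \<alpha>)) k)"
proof -
  note F = flagD[OF assms(1)]
  have rank: "vec_rank n d \<alpha> a = (\<Sum>k\<in>{1..n - 1}. psum a k) - (\<Sum>k\<in>{1..n - 1}. psum (Min (veronese_set n d \<alpha>)) k)" for a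
  proof -
    have "Suc (n - 1) = n" using assms(2) by simp
    then show ?thesis
      unfolding vec_rank_def Let_def left_diff_distrib sum_subtractf
      using sum_psum_eq[of a "n - 1"] sum_psum_eq[of "Min (veronese_set n d \<alpha>)" "n - 1"] by simp
  qed
  have "last vs = vs ! (n - 1)" using F(1) assms(2) by (subst last_conv_nth) auto
  moreover have "take (n - 1) \<sigma> = \<sigma>" using F(2) by simp
  ultimately have "psum (last vs) = lower (psum (vs ! 0)) {1..<n}"
    using F(6)[of "n - 1"] F(4) assms(2) by simp
  then have "(\<Sum>k\<in>{1..n - 1}. psum (last vs) k) = (\<Sum>k\<in>{1..n - 1}. psum (vs ! 0) k - 1)"
    by (intro sum.cong) (auto simp: lower_def)
  then show ?thesis
    by (simp add: clique_rank_def flag_vertices[OF assms(1)] rank sum_subtractf)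
qed

locale veronese_order = veronese_type +
  fixes L :: "vec set set \<Rightarrow> vec set" and prec :: "vec set rel"
  assumes n_ge: "2 \<le> n"
    and choice: "distinguished_choice n d \<alpha> L"
    and prec_sub: "prec \<subseteq> MC n d \<alpha> \<times> MC n d \<alpha>"
    and prec_linear: "strict_linear_order_on (MC n d \<alpha>) prec"
    and rules: "rules_of_order n d \<alpha> L prec"
begin

abbreviation start_weight :: "vec list \<Rightarrow> int" where
  "start_weight vs \<equiv> (\<Sum>k\<in>{1..n - 1}. psum (vs ! 0) k)"

lemma prec_asym: "(A, B) \<in> prec \<Longrightarrow> (B, A) \<notin> prec"
  using prec_linear unfolding strict_linear_order_on_def by (meson irreflD transD)

lemma prec_irrefl: "(A, A) \<notin> prec"
  using prec_asym by blast

lemma prec_if_smaller: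
  assumes "flag n d \<alpha> us \<pi>" "flag n d \<alpha> vs \<sigma>" "start_weight us < start_weight vs"
  shows "(set us, set vs) \<in> prec"
proof -
  have "clique_rank n d \<alpha> (set us) < clique_rank n d \<alpha> (set vs)"
    using assms(3) n_pos by (simp add: clique_rank_flag[OF assms(1)] clique_rank_flag[OF assms(2)])
  then show ?thesis
    using rules flag_MC[OF assms(1)] flag_MC[OF assms(2)] unfolding rules_of_order_def by blast
qed

lemma hd_vertices: "flag n d \<alpha> vs \<sigma> \<Longrightarrow> hd (vertices (set vs)) = vs ! 0"
  using flagD(1)[of n d \<alpha> vs \<sigma>] flag_vertices[of n d \<alpha> vs \<sigma>] n_pos by (cases vs) auto

text \<open>All that is used of the distinguished clique of a class: it starts with the same vertex, its
  signature \<open>\<tau>\<close> has the prescribed shape, and \<open>\<tau>\<close> governs the order within the class.\<close>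

lemma class_leader:
  assumes vs: "flag n d \<alpha> vs \<sigma>"
  obtains ls \<tau> where "flag n d \<alpha> ls \<tau>" "ls ! 0 = vs ! 0"
    "distinguished_signature n (kappa1 n (vs ! 0)) (kappa2 n \<alpha> (vs ! 0)) \<tau>"
    "\<And>us \<pi>. flag n d \<alpha> us \<pi> \<Longrightarrow> us ! 0 = vs ! 0 \<Longrightarrow> (set us, set vs) \<in> prec \<longleftrightarrow>
      (\<exists>i<n - 1. position \<tau> (\<pi> ! i) < position \<tau> (\<sigma> ! i) \<and> (\<forall>j<i. \<pi> ! j = \<sigma> ! j))"
proof -
  define E where "E = clique_class n d \<alpha> (set vs)"
  have leader: "L E \<in> E" "distinguished_signature n (kappa1 n (vs ! 0)) (kappa2 n \<alpha> (vs ! 0)) (signature n (L E))"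
    using choice[unfolded distinguished_choice_def Let_def, rule_format, OF flag_MC[OF vs]]
    by (simp_all only: E_def hd_vertices[OF vs])
  then obtain ls \<tau> where ls: "flag n d \<alpha> ls \<tau>" "L E = set ls"
    using MC_is_flag[of "L E"] unfolding E_def clique_class_def by blast
  have "hd (vertices B) = vs ! 0" if "B \<in> E" for B
    using that by (simp add: E_def clique_class_def hd_vertices[OF vs])
  from this[OF leader(1)] have "ls ! 0 = vs ! 0" unfolding ls(2) hd_vertices[OF ls(1)] .
  moreover have "signature n (L E) = \<tau>" using ls flag_signature by simp
  moreover have "(set us, set vs) \<in> prec \<longleftrightarrow>
      (\<exists>i<n - 1. position \<tau> (\<pi> ! i) < position \<tau> (\<sigma> ! i) \<and> (\<forall>j<i. \<pi> ! j = \<sigma> ! j))"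
    if us: "flag n d \<alpha> us \<pi>" "us ! 0 = vs ! 0" for us \<pi>
  proof -
    have "set us \<in> E" using us flag_MC[OF us(1)]
      by (simp add: E_def clique_class_def hd_vertices[OF vs] hd_vertices[OF us(1)])
    then have "(set us, set vs) \<in> prec \<longleftrightarrow>
        first_diff_neg (relative_signature \<tau> \<pi>) (relative_signature \<tau> \<sigma>)"
      using rules flag_MC[OF vs] \<open>signature n (L E) = \<tau>\<close> flag_signature[OF vs] flag_signature[OF us(1)]
      unfolding rules_of_order_def Let_def E_def by metis
    then show ?thesis
      using first_diff_neg_relative_iff[of \<tau> \<pi> \<sigma>] flagD(2-4)[OF vs] flagD(2-4)[OF us(1)] flagD(2-4)[OF ls(1)]
      by simp
  qed
  ultimately show thesis using that ls(1) leader(2) by blast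
qed

text \<open>At these indices the partial sum of \<open>a\<close>, the first vertex of a maximal clique, is as small as
  that of the first vertex of a maximal clique can be. On the left its entries are as small as
  possible, namely \<open>1, 0, \<dots>, 0\<close>; on the right they are as large as possible.\<close>

definition tight :: "vec \<Rightarrow> nat set" where
  "tight a = {k \<in> {1..<n}. k \<le> kappa1 n a \<or> kappa2 n \<alpha> a \<le> k + 1}"

lemma flag_admissible:
  assumes "flag n d \<alpha> vs \<sigma>"
  shows "admissible n d \<alpha> (psum (vs ! 0))" "admissible n d \<alpha> (lower (psum (vs ! 0)) {1..<n})"
proof -
  note F = flagD[OF assms]
  show "admissible n d \<alpha> (psum (vs ! 0))" using F(5)[of 0] n_pos by (intro admissible_psum) simp
  have "psum (vs ! (n - 1)) = lower (psum (vs ! 0)) {1..<n}"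
    using F(6)[of "n - 1"] F(2,4) n_pos by simp
  then show "admissible n d \<alpha> (lower (psum (vs ! 0)) {1..<n})"
    using admissible_psum[OF F(5)[of "n - 1"]] n_pos by simp
qed

lemma kappa1_pos:
  assumes "psum a 1 \<le> 1"
  shows "1 \<le> kappa1 n a" "\<And>k. k \<le> kappa1 n a \<Longrightarrow> 1 \<le> k \<Longrightarrow> psum a k \<le> 1"
proof -
  let ?S = "{k \<in> {1..n - 1}. \<forall>j\<in>{2..k}. Poly_Mapping.lookup a j = 0}"
  have k1: "kappa1 n a = Max ?S" using assms lookup_psum[of 1 a] by (simp add: kappa1_def)
  have S: "finite ?S" "1 \<in> ?S" using n_ge by auto
  then show "1 \<le> kappa1 n a" unfolding k1 by (rule Max_ge)
  have "Max ?S \<in> ?S" using S by (intro Max_in) blast+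
  then have zero: "\<forall>j\<in>{2..kappa1 n a}. Poly_Mapping.lookup a j = 0" unfolding k1 by blast
  fix k assume "k \<le> kappa1 n a" "1 \<le> k"
  then show "psum a k \<le> 1"
  proof (induction k)
    case (Suc k)
    then show ?case using assms zero psum_Suc[of a k] by (cases "k = 0") simp_all
  qed simp
qed

lemma kappa2_le:
  assumes "\<alpha> n \<le> Poly_Mapping.lookup a n + 1"
  shows "kappa2 n \<alpha> a \<le> n" "\<And>j. kappa2 n \<alpha> a \<le> j \<Longrightarrow> j \<le> n - 1 \<Longrightarrow> Poly_Mapping.lookup a j = \<alpha> j"
proof -
  let ?S = "{k \<in> {2..n}. \<forall>j\<in>{k..n - 1}. Poly_Mapping.lookup a j = \<alpha> j}"
  have k2: "kappa2 n \<alpha> a = Min ?S" using assms by (simp add: kappa2_def)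
  have S: "finite ?S" "n \<in> ?S" using n_ge by auto
  then show "kappa2 n \<alpha> a \<le> n" unfolding k2 by (rule Min_le)
  have "Min ?S \<in> ?S" using S by (intro Min_in) blast+
  then have "\<forall>j\<in>{kappa2 n \<alpha> a..n - 1}. Poly_Mapping.lookup a j = \<alpha> j" unfolding k2 by blast
  then show "Poly_Mapping.lookup a j = \<alpha> j" if "kappa2 n \<alpha> a \<le> j" "j \<le> n - 1" for j
    using that by simp
qed

text \<open>The first vertex of a maximal clique has a first entry of at least \<open>1\<close> and a last entry of at
  most \<open>\<alpha>\<^sub>n - 1\<close>, because these two entries change once, and in one direction only. Partial sums from
  the left are therefore at least \<open>1\<close>, and summing from the right gives the other bound.\<close>

lemma tight_minimal:
  assumes vs: "flag n d \<alpha> vs \<sigma>" and us: "flag n d \<alpha> us \<pi>" and k: "k \<in> tight (vs ! 0)"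
  shows "psum (vs ! 0) k \<le> psum (us ! 0) k"
proof -
  define f where "f = psum (vs ! 0)"
  define g where "g = psum (us ! 0)"
  have f: "f 0 = 0" "f n = int d" using flag_admissible(1)[OF vs] by (simp_all add: admissible_def f_def)
  have g: "g (j - 1) \<le> g j" "g j \<le> g (j - 1) + int (\<alpha> j)" if "j \<in> {1..n}" for j
    using flag_admissible(1)[OF us] that by (simp_all add: admissible_def g_def)
  have "g 0 = 0" "g n = int d" using flag_admissible(1)[OF us] by (simp_all add: admissible_def g_def)
  have lowg: "lower g {1..<n} (j - 1) \<le> lower g {1..<n} j" "lower g {1..<n} j \<le> lower g {1..<n} (j - 1) + int (\<alpha> j)"
    if "j \<in> {1..n}" for j
    using flag_admissible(2)[OF us] that by (simp_all add: admissible_def g_def)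
  have g1: "1 \<le> g 1" using lowg(1)[of 1] n_ge \<open>g 0 = 0\<close> by (simp add: lower_def)
  have "n - 1 \<in> {1..<n}" using n_ge by auto
  then have gn: "int d + 1 \<le> g (n - 1) + int (\<alpha> n)"
    using lowg(2)[of n] n_ge \<open>g n = int d\<close> unfolding lower_def by simp
  have k1n: "1 \<le> k" "k < n" using k by (auto simp: tight_def)
  consider "k \<le> kappa1 n (vs ! 0)" | "kappa2 n \<alpha> (vs ! 0) \<le> k + 1" using k by (auto simp: tight_def)
  then have "f k \<le> g k"
  proof cases
    case 1
    then have "psum (vs ! 0) 1 \<le> 1"
      using k1n lookup_psum[of 1 "vs ! 0"] by (simp add: kappa1_def split: if_splits)
    then have "f k \<le> 1" using kappa1_pos(2) 1 k1n by (simp add: f_def)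
    moreover have "1 \<le> g k" using k1n
    proof (induction k rule: dec_induct)
      case (step j)
      then show ?case using g(1)[of "Suc j"] by simp
    qed (use g1 in simp)
    ultimately show ?thesis by simp
  next
    case 2
    then have le: "\<alpha> n \<le> Poly_Mapping.lookup (vs ! 0) n + 1"
      using k1n by (simp add: kappa2_def split: if_splits)
    have "k \<le> n - 1" using k1n by simp
    then have "k \<le> j \<Longrightarrow> j \<le> n - 1 \<Longrightarrow> f j \<le> g j" for j
    proof (induction "n - 1 - j" arbitrary: j)
      case 0
      then have "j = n - 1" by simp
      then show ?case using gn le lookup_psum[of n "vs ! 0"] f n_ge by (simp add: f_def)
    next
      case (Suc m)
      then have j: "Suc j \<le> n - 1" "f (Suc j) \<le> g (Suc j)" by auto
      then have "Poly_Mapping.lookup (vs ! 0) (Suc j) = \<alpha> (Suc j)"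
        using kappa2_le(2)[OF le, of "Suc j"] 2 Suc.prems by simp
      then have "f (Suc j) = f j + int (\<alpha> (Suc j))" by (simp add: f_def psum_Suc)
      moreover have "Suc j \<in> {1..n}" using j(1) by auto
      ultimately show ?case using j(2) g(2)[of "Suc j"] by simp
    qed
    then show ?thesis using \<open>k \<le> n - 1\<close> by blast
  qed
  then show ?thesis by (simp add: f_def g_def)
qed

text \<open>This is the purpose of the shape of the distinguished signature: its final blocks
  \<open>n - 1, \<dots>, \<kappa>\<^sub>2 - 1\<close> and \<open>1, \<dots>, \<kappa>\<^sub>1\<close> are exactly the tight indices. If \<open>\<kappa>\<^sub>1 + 1 = \<kappa>\<^sub>2\<close>, all
  indices are tight.\<close>

lemma position_tight:
  assumes "distinguished_signature n (kappa1 n a) (kappa2 n \<alpha> a) \<tau>" "distinct \<tau>" "set \<tau> = {1..<n}"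
    and "x \<in> tight a" "y \<in> {1..<n} - tight a"
  shows "position \<tau> y < position \<tau> x"
proof (cases "kappa1 n a + 1 < kappa2 n \<alpha> a")
  case True
  then obtain t where t: "\<tau> = t @ (rev [kappa2 n \<alpha> a - 1..<n] @ [1..<kappa1 n a + 1])"
    using assms(1) unfolding distinguished_signature_def by auto
  define r where "r = rev [kappa2 n \<alpha> a - 1..<n] @ [1..<kappa1 n a + 1]"
  have \<tau>: "\<tau> = t @ r" by (simp add: t r_def)
  have dist: "distinct (t @ r)" using assms(2) \<tau> by simp
  have "set r = {kappa2 n \<alpha> a - 1..<n} \<union> {1..<kappa1 n a + 1}"
    unfolding r_def by (simp only: set_append set_rev set_upt)
  then have "x \<in> set r" "y \<notin> set r" using assms(4,5) by (auto simp: tight_def)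
  moreover have "y \<in> set t \<union> set r" using assms(3,5) unfolding \<tau> set_append by blast
  ultimately have "position (t @ r) y < length t" "length t \<le> position (t @ r) x"
    using position_append[OF dist] by blast+
  then show ?thesis unfolding \<tau> by linarith
next
  case False
  then have "set \<tau> = {kappa2 n \<alpha> a..<n} \<union> {1..<kappa1 n a + 1}"
    using assms(1) unfolding distinguished_signature_def
    by (simp only: if_False set_append set_rev set_upt)
  moreover have "y \<in> set \<tau>" using assms(3,5) by simp
  ultimately have "y \<in> tight a" using assms(3) unfolding tight_def by auto
  then show ?thesis using assms(5) by simp
qed

lemma psum_le_first:
  assumes "flag n d \<alpha> us \<pi>" "v \<in> set us"
  shows "psum v k \<le> psum (us ! 0) k"
proof -
  obtain j where "j < n" "v = us ! j" using assms flagD(1) by (metis in_set_conv_nth)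
  then show ?thesis using flagD(6)[OF assms(1), of j] by (simp add: lower_def)
qed

text \<open>If \<open>us\<close> started above \<open>vs\<close>, its rank would be at least as large, and equal only for the same
  first vertex; but a preceding clique has no larger rank.\<close>

lemma not_above:
  assumes vs: "flag n d \<alpha> vs \<sigma>" and us: "flag n d \<alpha> us \<pi>"
    and prec: "(set us, set vs) \<in> prec" and ne: "us ! 0 \<noteq> vs ! 0"
    and le: "\<And>k. k \<in> {1..<n} \<Longrightarrow> psum (vs ! 0) k \<le> psum (us ! 0) k"
  shows False
proof -
  have range: "{1..n - 1} = {1..<n}" by (cases n) (simp_all add: atLeastLessThanSuc_atLeastAtMost)
  have "start_weight vs \<le> start_weight us" unfolding range using le by (rule sum_mono)
  moreover have "\<not> start_weight vs < start_weight us" using prec_if_smaller[OF vs us] prec prec_asym by blast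
  ultimately have "start_weight vs = start_weight us" by simp
  then have eq: "psum (vs ! 0) k = psum (us ! 0) k" if "k \<in> {1..<n}" for k
    unfolding range using sum_mono_inv[of "psum (vs ! 0)" "{1..<n}" "psum (us ! 0)" k] le that by auto
  have "psum (vs ! 0) k = psum (us ! 0) k" for k
    using eq[of k] flag_admissible(1)[OF vs] flag_admissible(1)[OF us]
    by (cases "k \<in> {1..<n}"; cases "k = 0") (auto simp: admissible_def)
  then have "us ! 0 = vs ! 0"
    using n_pos by (intro psum_inject flag_keys[OF us] flag_keys[OF vs]) auto
  then show False using ne by simp
qed

text \<open>The vertex \<open>v\<close> is found at a descent of \<open>\<sigma>\<close> with respect to \<open>\<tau>\<close>, or it is the first vertex of
  \<open>vs\<close>. In the same class, the descent lies between the first difference \<open>i\<close> of the signatures and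
  the position \<open>q\<close> where \<open>\<sigma>\<close> takes the step \<open>\<pi> ! i\<close>; between these positions the vertices of \<open>ws\<close>
  have taken that step and those of \<open>vs\<close> have not. In another class, it is the place where \<open>\<sigma>\<close> first
  leaves the tight indices, and \<open>ws\<close> misses the vertex there because it would otherwise start above
  \<open>vs\<close>.\<close>

lemma flag_exchange:
  assumes vs: "flag n d \<alpha> vs \<sigma>" and ws: "flag n d \<alpha> ws \<pi>" and prec: "(set ws, set vs) \<in> prec"
  obtains us \<rho> v where "flag n d \<alpha> us \<rho>" "(set us, set vs) \<in> prec" "set vs - set us \<subseteq> {v}" "v \<notin> set ws"
proof -
  note found = that
  note F = flagD[OF vs] and G = flagD[OF ws]
  obtain ls \<tau> where ls: "flag n d \<alpha> ls \<tau>" "ls ! 0 = vs ! 0"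
    "distinguished_signature n (kappa1 n (vs ! 0)) (kappa2 n \<alpha> (vs ! 0)) \<tau>"
    and order: "\<And>us \<pi>. flag n d \<alpha> us \<pi> \<Longrightarrow> us ! 0 = vs ! 0 \<Longrightarrow> (set us, set vs) \<in> prec \<longleftrightarrow>
      (\<exists>i<n - 1. position \<tau> (\<pi> ! i) < position \<tau> (\<sigma> ! i) \<and> (\<forall>j<i. \<pi> ! j = \<sigma> ! j))"
    using class_leader[OF vs] by blast
  note T = flagD(3,4)[OF ls(1)]
  have descent: thesis
    if p: "Suc p < n - 1" "position \<tau> (\<sigma> ! Suc p) < position \<tau> (\<sigma> ! p)" "vs ! Suc p \<notin> set ws" for p
  proof -
    let ?\<rho> = "\<sigma>[p := \<sigma> ! Suc p, Suc p := \<sigma> ! p]"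
    obtain us where us: "flag n d \<alpha> us ?\<rho>" "us ! 0 = vs ! 0" "set vs - set us \<subseteq> {vs ! Suc p}"
      using flag_swap[OF vs ls(1,2) p(1,2)] by blast
    have "position \<tau> (?\<rho> ! p) < position \<tau> (\<sigma> ! p)" "\<forall>j<p. ?\<rho> ! j = \<sigma> ! j"
      using p(1,2) F(2) by simp_all
    moreover have "p < n - 1" using p(1) by simp
    ultimately have "(set us, set vs) \<in> prec" using order[OF us(1,2)] by blast
    then show thesis using found us(1,3) p(3) by blast
  qed
  show thesis
  proof (cases "ws ! 0 = vs ! 0")
    case True
    then obtain i where i: "i < n - 1" "position \<tau> (\<pi> ! i) < position \<tau> (\<sigma> ! i)" "\<forall>j<i. \<pi> ! j = \<sigma> ! j"
      using order[OF ws] prec by blast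
    define y where "y = \<pi> ! i"
    have "y \<in> set \<pi>" using i(1) G(2) by (simp add: y_def)
    then have "y \<in> set \<sigma>" using F(4) G(4) by simp
    then obtain q where q: "q < n - 1" "\<sigma> ! q = y" using F(2) by (auto simp: in_set_conv_nth)
    have "\<not> q < i"
    proof
      assume "q < i"
      then have "\<pi> ! q = \<pi> ! i" using i(3) q(2) y_def by simp
      then show False using \<open>q < i\<close> i(1) G(2,3) by (simp add: nth_eq_iff_index_eq)
    qed
    moreover have "q \<noteq> i" using i(2) q(2) by (auto simp: y_def)
    ultimately have "i < q" by simp
    have "\<exists>p. i \<le> p \<and> p < q \<and> position \<tau> (\<sigma> ! Suc p) < position \<tau> (\<sigma> ! p)"
    proof (rule ccontr)
      assume no: "\<not> ?thesis"
      have "position \<tau> (\<sigma> ! i) \<le> position \<tau> (\<sigma> ! k)" if "i \<le> k" "k \<le> q" for k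
        using that
      proof (induction k rule: dec_induct)
        case (step k)
        then show ?case using no by (metis Suc_le_lessD le_trans less_imp_le_nat not_le)
      qed simp
      then have "position \<tau> (\<sigma> ! i) \<le> position \<tau> (\<sigma> ! q)" using \<open>i < q\<close> by simp
      then show False using i(2) q(2) by (simp add: y_def)
    qed
    then obtain p where p: "i \<le> p" "p < q" "position \<tau> (\<sigma> ! Suc p) < position \<tau> (\<sigma> ! p)" by blast
    have "vs ! Suc p \<notin> set ws"
    proof
      assume "vs ! Suc p \<in> set ws"
      then obtain j where j: "j < n" "vs ! Suc p = ws ! j" using G(1) by (metis in_set_conv_nth)
      have sp: "Suc p < n" using p(2) q(1) by simp
      have "set (take (Suc p) \<sigma>) = set (take j \<pi>)"
        using F(6)[OF sp] G(6)[OF j(1)] j(2) True lower_inject by metis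
      moreover from this have "Suc p = j"
        using F(2,3) G(2,3) sp j(1) distinct_card[of "take (Suc p) \<sigma>"] distinct_card[of "take j \<pi>"] by simp
      moreover have "y \<in> set (take (Suc p) \<pi>)"
        using p(1) i(1) G(2) sp unfolding y_def by (auto simp: in_set_conv_nth intro!: exI[of _ i])
      ultimately have "y \<in> set (take (Suc p) \<sigma>)" by simp
      then obtain j' where "j' < Suc p" "\<sigma> ! j' = y" by (auto simp: in_set_conv_nth)
      then show False using q p(2) F(2,3) nth_eq_iff_index_eq[of \<sigma> j' q] by simp
    qed
    moreover have "Suc p < n - 1" using p(2) q(1) by simp
    ultimately show thesis using descent p(3) by blast
  next
    case False
    have some_lower: "\<exists>k\<in>{1..<n}. psum (ws ! 0) k < psum (vs ! 0) k"
      using not_above[OF vs ws prec False] by (meson not_le)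
    have first_out: "vs ! 0 \<notin> set ws"
      using some_lower psum_le_first[OF ws] by (meson not_le)
    show thesis
    proof (cases "(\<sigma> ! 0 = 1 \<longrightarrow> 2 \<le> psum (vs ! 0) 1) \<and>
        (\<sigma> ! 0 = n - 1 \<longrightarrow> int d + 2 \<le> psum (vs ! 0) (n - 1) + int (\<alpha> n))")
      case True
      then obtain us \<rho> where us: "flag n d \<alpha> us \<rho>" "us ! 0 = vs ! 1" "set vs - set us \<subseteq> {vs ! 0}"
        using flag_rotate[OF vs n_ge] by blast
      have "psum (vs ! 1) = lower (psum (vs ! 0)) {\<sigma> ! 0}" using flag_step[OF vs, of 0] n_ge by simp
      moreover have "\<sigma> ! 0 \<in> {1..n - 1}"
        using F(2,4) n_ge nth_mem[of 0 \<sigma>] by auto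
      ultimately have "start_weight us < start_weight vs"
        unfolding us(2) by (intro sum_strict_mono_ex1) (auto simp: lower_def)
      then show thesis using found[OF us(1) _ us(3) first_out] prec_if_smaller[OF us(1) vs] by blast
    next
      case blocked: False
      have "\<sigma> ! 0 \<in> tight (vs ! 0)"
      proof -
        have f: "psum (vs ! 0) n = int d" using flag_admissible(1)[OF vs] by (simp add: admissible_def)
        have "kappa1 n (vs ! 0) \<ge> 1" if "\<sigma> ! 0 = 1" "psum (vs ! 0) 1 < 2"
          using kappa1_pos(1)[of "vs ! 0"] that by simp
        moreover have "kappa2 n \<alpha> (vs ! 0) \<le> n"
          if "psum (vs ! 0) (n - 1) + int (\<alpha> n) < int d + 2"
          using kappa2_le(1)[of "vs ! 0"] that lookup_psum[of n "vs ! 0"] f n_ge by simp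
        ultimately show ?thesis using blocked n_ge by (auto simp: tight_def not_le)
      qed
      have "\<not> {1..<n} \<subseteq> tight (vs ! 0)"
        using some_lower tight_minimal[OF vs ws] by (meson not_le subsetD)
      then obtain x where "x \<in> set \<sigma>" "x \<notin> tight (vs ! 0)" using F(4) by blast
      then have ex: "\<exists>i<n - 1. \<sigma> ! i \<notin> tight (vs ! 0)" using F(2) by (metis in_set_conv_nth)
      define q where "q = (LEAST i. i < n - 1 \<and> \<sigma> ! i \<notin> tight (vs ! 0))"
      have q: "q < n - 1" "\<sigma> ! q \<notin> tight (vs ! 0)"
        using LeastI_ex[OF ex[unfolded Bex_def]] unfolding q_def by blast+
      have before: "\<sigma> ! i \<in> tight (vs ! 0)" if "i < q" for i
        using not_less_Least[of i "\<lambda>i. i < n - 1 \<and> \<sigma> ! i \<notin> tight (vs ! 0)"] that q(1)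
        unfolding q_def[symmetric] by auto
      obtain p where p: "q = Suc p" using q(2) \<open>\<sigma> ! 0 \<in> _\<close> by (cases q) auto
      have "\<sigma> ! q \<in> {1..<n}" using F(2,4) q(1) nth_mem[of q \<sigma>] by simp
      then have desc: "position \<tau> (\<sigma> ! Suc p) < position \<tau> (\<sigma> ! p)"
        using position_tight[OF ls(3) T, of "\<sigma> ! p" "\<sigma> ! q"] before[of p] q(2) p by simp
      have "vs ! Suc p \<notin> set ws"
      proof
        assume "vs ! Suc p \<in> set ws"
        \<comment> \<open>The indices lowered so far are tight, and at the others the vertex agrees with \<open>vs ! 0\<close>.\<close>
        have "psum (vs ! 0) k \<le> psum (ws ! 0) k" if "k \<in> {1..<n}" for k
        proof (cases "k \<in> set (take q \<sigma>)")
          case True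
          then obtain i where "i < q" "\<sigma> ! i = k" by (auto simp: in_set_conv_nth)
          then show ?thesis using before tight_minimal[OF vs ws] by blast
        next
          case False
          then have "psum (vs ! 0) k = psum (vs ! q) k" using F(6)[of q] q(1) by (simp add: lower_def)
          then show ?thesis using psum_le_first[OF ws \<open>vs ! Suc p \<in> _\<close>] p by simp
        qed
        then show False using some_lower by (meson not_le)
      qed
      then show thesis using descent desc q(1) p by blast
    qed
  qed
qed

text \<open>Distinct maximal cliques are not contained in each other, so the difference is not empty.\<close>

lemma MC_exchange:
  assumes "(B, A) \<in> prec"
  shows "\<exists>C\<in>{C. (C, A) \<in> prec}. \<exists>v. A - C = {v} \<and> v \<notin> B"
proof -
  have MC: "A \<in> MC n d \<alpha>" "B \<in> MC n d \<alpha>" using assms prec_sub by auto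
  obtain vs \<sigma> where vs: "flag n d \<alpha> vs \<sigma>" "A = set vs" using MC_is_flag[OF MC(1)] by blast
  obtain ws \<pi> where ws: "flag n d \<alpha> ws \<pi>" "B = set ws" using MC_is_flag[OF MC(2)] by blast
  obtain us \<rho> v where us: "flag n d \<alpha> us \<rho>" "(set us, A) \<in> prec" "A - set us \<subseteq> {v}" "v \<notin> B"
    using flag_exchange[OF vs(1) ws(1)] assms vs(2) ws(2) by blast
  have "A \<noteq> set us" using us(2) prec_irrefl by blast
  then have "\<not> A \<subseteq> set us" using MC_antichain[OF MC(1) flag_MC[OF us(1)]] by blast
  then have "A - set us = {v}" using us(3) by blast
  then show ?thesis using us(2,4) by blast
qed

end

theorem theorem4p22:
  fixes n d :: nat and \<alpha> :: "nat \<Rightarrow> nat"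
    and L :: "vec set set \<Rightarrow> vec set" and prec :: "vec set rel"
  assumes "n \<ge> 3" and "d \<ge> 1"
    and "\<And>i. i \<in> {1..n} \<Longrightarrow> 1 \<le> \<alpha> i \<and> \<alpha> i \<le> d"
    and "\<And>i j. 1 \<le> i \<Longrightarrow> i \<le> j \<Longrightarrow> j \<le> n \<Longrightarrow> \<alpha> i \<le> \<alpha> j"
    and "d < (\<Sum>i\<in>{1..n}. \<alpha> i)"
    and "distinguished_choice n d \<alpha> L"
    and "prec \<subseteq> MC n d \<alpha> \<times> MC n d \<alpha>"
    and "strict_linear_order_on (MC n d \<alpha>) prec"
    and "rules_of_order n d \<alpha> L prec"
  shows "(\<forall>r. sorting_term_order n d \<alpha> TYPE('k::field) r \<longrightarrow>
            minimal_monomial_generating_set (veronese_set n d \<alpha>)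
              (alexander_dual (veronese_set n d \<alpha>)
                 (initial_ideal (veronese_set n d \<alpha>) r (presentation_ideal n d \<alpha>)))
              {T_compl n d \<alpha> A :: (vec, 'k) mpoly | A. A \<in> MC n d \<alpha>}) \<and>
         (\<forall>A\<in>MC n d \<alpha>. \<exists>S \<subseteq> veronese_set n d \<alpha>.
            colon_ideal (poly_ring (veronese_set n d \<alpha>))
              (Idl\<^bsub>poly_ring (veronese_set n d \<alpha>)\<^esub> {T_compl n d \<alpha> B | B. (B, A) \<in> prec})
              (T_compl n d \<alpha> A :: (vec, 'k) mpoly)
            = Idl\<^bsub>poly_ring (veronese_set n d \<alpha>)\<^esub> (var ` S))"
proof (intro conjI allI impI ballI)
  fix r assume "sorting_term_order n d \<alpha> TYPE('k) r"
  then show "minimal_monomial_generating_set (veronese_set n d \<alpha>)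
      (alexander_dual (veronese_set n d \<alpha>)
        (initial_ideal (veronese_set n d \<alpha>) r (presentation_ideal n d \<alpha>)))
      {T_compl n d \<alpha> A :: (vec, 'k) mpoly | A. A \<in> MC n d \<alpha>}"
    by (rule alexander_dual_minimal_generators)
next
  fix A assume A: "A \<in> MC n d \<alpha>"
  interpret veronese_order n d \<alpha> L prec
    by unfold_locales (use assms in auto)
  let ?V = "veronese_set n d \<alpha>" and ?\<B> = "{B. (B, A) \<in> prec}"
  have gens: "{T_compl n d \<alpha> B :: (vec, 'k) mpoly | B. (B, A) \<in> prec} = (\<lambda>B. sqfree_mono (?V - B)) ` ?\<B>"
    by (auto simp: T_compl_def)
  have "B \<subseteq> ?V" if "B \<in> ?\<B>" for B using that prec_sub MC_subset by blast
  then show "\<exists>S \<subseteq> ?V. colon_ideal (poly_ring ?V)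
      (Idl\<^bsub>poly_ring ?V\<^esub> {T_compl n d \<alpha> B | B. (B, A) \<in> prec}) (T_compl n d \<alpha> A :: (vec, 'k) mpoly)
    = Idl\<^bsub>poly_ring ?V\<^esub> (var ` S)"
    unfolding gens unfolding T_compl_def
    using MC_exchange by (intro linear_colon finite_veronese_set MC_subset[OF A]) auto
qed

end
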